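(* Let $\mathrm{T}>0$. For every $t \in [0,\mathrm{T})$ and every $u_0\in C^\infty_b(\mathbb{R})$, with $\kappa = \max ( \| u_0 \|_{\infty},1)$, we have $$\left\| T^tu_0 - X^t Y^t u_0 \right\|_{\infty} \leq \frac{4\kappa\, t\sqrt{t}\, \exp \left( t \|f'\|_{[-\kappa,\kappa]} \right) \|f''\|_{[-\kappa,\kappa]} }{3\sqrt{\pi}} \left\| \partial_x u_0 \right\|_{\infty},$$ $$\left\| T^tu_0 - Y^t X^t u_0 \right\|_{\infty} \leq \frac{2\, t\sqrt{t}\, \exp \left( 2t \|f'\|_{[-\kappa,\kappa]} \right) \|f''\|_{[-\kappa,\kappa]} }{3\sqrt{\pi}} \left\| u_0 \right\|_{\infty} \left\| \partial_x u_0 \right\|_{\infty},$$ and $$\left\| T^tu_0 - Y^t X^t u_0 \right\|_{\infty} \leq \frac{t \exp \left( 2t \|f'\|_{[-\kappa,\kappa]} \right) \|f''\|_{[-\kappa,\kappa]}}{\pi} \left\| u_0 \right\|_{\infty}^2.$$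
   Context: $C^\infty_b(\mathbb{R})$ denotes the space of functions of class $C^\infty$ on $\mathbb{R}$ that are bounded over $\mathbb{R}$, with the maximum norm $\|\cdot\|_\infty$. The function $f:\mathbb{R}\to\mathbb{R}$ is of class $C^\infty$ with $f(0)=0$ and satisfies: $|r|\ge 1 \Rightarrow r f(r)\le 0$. For a continuous scalar function $g$ and real $a$, $\|g\|_{[-a,a]}=\sup_{r\in[-a,a]}|g(r)|$. For initial data in $C^\infty_b(\mathbb{R})$ and $t\ge 0$ define three (bounded-solution) semi-flows: - $T^tu_0$ is the solution $u(\cdot,t)$ of $\partial_t u-\partial_x^2 u=f(u)$ on $\mathbb{R}\times(0,\infty)$, $u(\cdot,0)=u_0$; - $X^tv_0$ is the solution $v(\cdot,t)$ of the heat equation $\partial_t v-\partial_x^2 v=0$, $v(\cdot,0)=v_0$ (given by the heat semi-group, i.e. Gauss–Weierstrass convolution); - $Y^tw_0$ is the solution $w(\cdot,t)$ of $\partial_t w=f(w)$ (pointwise in $x$), $w(\cdot,0)=w_0$. Compositions are read as $X^tY^tu_0=X^t(Y^tu_0)$. *)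

theory Defs
  imports "HOL-Analysis.Analysis"
begin

definition smooth :: "(real \<Rightarrow> real) \<Rightarrow> bool" where
  "smooth g \<longleftrightarrow> (\<forall>n x. (deriv ^^ n) g differentiable (at x))"

text \<open>
  Only the function itself is required to be bounded, not its derivatives.
\<close>

definition Cb_infty :: "(real \<Rightarrow> real) set" where
  "Cb_infty = {g. smooth g \<and> bounded (range g)}"

text \<open>
  The norm over the whole line takes values in \<open>[0,\<infinity>]\<close>, because the derivative
  of a member of \<^const>\<open>Cb_infty\<close> may be unbounded. In products \<open>0 * \<infinity> = 0\<close>.
\<close>

definition sup_norm :: "(real \<Rightarrow> real) \<Rightarrow> ennreal" where
  "sup_norm g = (SUP x. ennreal \<bar>g x\<bar>)"

text \<open>Meant for continuous \<open>g\<close> and \<open>a \<ge> 0\<close>, where the supremum is finite.\<close>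

definition sup_norm_on :: "real \<Rightarrow> (real \<Rightarrow> real) \<Rightarrow> real" where
  "sup_norm_on a g = (SUP r\<in>{-a..a}. \<bar>g r\<bar>)"

text \<open>
  Bounded classical solutions of \<open>u\<^sub>t - u\<^sub>x\<^sub>x = f(u)\<close>, \<open>u(\<cdot>,0) = u\<^sub>0\<close>, with \<open>u t x\<close>
  standing for \<open>u(x,t)\<close>: continuous up to \<open>t = 0\<close> and bounded on every strip
  \<open>[0,\<tau>] \<times> \<real>\<close>, the class in which solutions are unique. Values at
  negative times are irrelevant.
\<close>

definition reaction_diffusion_solution ::
  "(real \<Rightarrow> real) \<Rightarrow> (real \<Rightarrow> real) \<Rightarrow> (real \<Rightarrow> real \<Rightarrow> real) \<Rightarrow> bool" where
  "reaction_diffusion_solution f u0 u \<longleftrightarrow>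
     u 0 = u0 \<and>
     continuous_on ({0..} \<times> UNIV) (\<lambda>(t, x). u t x) \<and>
     (\<forall>\<tau>. bounded ((\<lambda>(t, x). u t x) ` ({0..\<tau>} \<times> UNIV))) \<and>
     (\<exists>ut ux uxx. \<forall>t>0. \<forall>x.
        ((\<lambda>s. u s x) has_real_derivative ut t x) (at t) \<and>
        (u t has_real_derivative ux t x) (at x) \<and>
        (ux t has_real_derivative uxx t x) (at x) \<and>
        ut t x - uxx t x = f (u t x))"

definition reaction_solution ::
  "(real \<Rightarrow> real) \<Rightarrow> (real \<Rightarrow> real) \<Rightarrow> (real \<Rightarrow> real \<Rightarrow> real) \<Rightarrow> bool" where
  "reaction_solution f w0 w \<longleftrightarrow>
     w 0 = w0 \<and>
     (\<forall>t\<ge>0. \<forall>x. ((\<lambda>s. w s x) has_real_derivative f (w t x)) (at t within {0..}))"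

text \<open>
  The semi-flows act on functions: \<open>T t u0\<close> is the solution at time \<open>t\<close> started from
  \<open>u0\<close>, so that \<open>X t (Y t u0)\<close> is the composition \<open>X\<^sup>t Y\<^sup>t u\<^sub>0\<close>. Uniqueness of solutions
  determines \<open>T t u0\<close> and \<open>Y t u0\<close> for \<open>t \<ge> 0\<close> and \<open>u0\<close> in \<^const>\<open>Cb_infty\<close>.
\<close>

definition reaction_diffusion_semiflow ::
  "(real \<Rightarrow> real) \<Rightarrow> (real \<Rightarrow> (real \<Rightarrow> real) \<Rightarrow> real \<Rightarrow> real) \<Rightarrow> bool" where
  "reaction_diffusion_semiflow f T \<longleftrightarrow>
     (\<forall>u0\<in>Cb_infty. reaction_diffusion_solution f u0 (\<lambda>t. T t u0))"

definition reaction_semiflow ::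
  "(real \<Rightarrow> real) \<Rightarrow> (real \<Rightarrow> (real \<Rightarrow> real) \<Rightarrow> real \<Rightarrow> real) \<Rightarrow> bool" where
  "reaction_semiflow f Y \<longleftrightarrow>
     (\<forall>w0\<in>Cb_infty. reaction_solution f w0 (\<lambda>t. Y t w0))"

definition heat_kernel :: "real \<Rightarrow> real \<Rightarrow> real" where
  "heat_kernel t z = exp (- z\<^sup>2 / (4 * t)) / sqrt (4 * pi * t)"

definition heat_semigroup :: "real \<Rightarrow> (real \<Rightarrow> real) \<Rightarrow> real \<Rightarrow> real" where
  "heat_semigroup t v0 =
     (if t = 0 then v0 else (\<lambda>x. \<integral>y. heat_kernel t (x - y) * v0 y \<partial>lborel))"

end

theory Submission
  imports Defs "HOL-Probability.Distributions"
begin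

text \<open>
  Each splitting product, as a function of \<open>t\<close>, solves the reaction--diffusion equation up to a
  defect, and all three estimates come from bounding that defect and comparing with the exact
  solution by a maximum principle.

  Write \<open>\<phi>(t,r)\<close> for the flow of \<open>y' = f(y)\<close>, so that \<open>Y\<^sup>t w\<^sub>0 = \<phi>(t, w\<^sub>0)\<close>, and put \<open>v = X\<^sup>t u\<^sub>0\<close>.
  The function \<open>w = Y\<^sup>t X\<^sup>t u\<^sub>0 = \<phi>(t, v)\<close> satisfies
  \<open>w\<^sub>t - w\<^sub>x\<^sub>x = f(w) - \<phi>\<^sub>r\<^sub>r(t,v) v\<^sub>x\<^sup>2\<close>. Here
  \<open>\<bar>\<phi>\<^sub>r\<^sub>r\<bar> \<le> t M\<^sub>2 exp (2 t M)\<close>, where \<open>M\<close> and \<open>M\<^sub>2\<close> bound \<open>f'\<close> and \<open>f''\<close> on \<open>[-\<kappa>,\<kappa>]\<close>. The Gaussian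
  kernel gives \<open>\<bar>v\<^sub>x\<bar> \<le> \<parallel>u\<^sub>0\<parallel> / sqrt (\<pi> t)\<close>, and translation invariance gives
  \<open>\<bar>v\<^sub>x\<bar> \<le> \<parallel>\<partial>\<^sub>x u\<^sub>0\<parallel>\<close>. Using the first bound twice leads to the estimate with
  \<open>\<parallel>u\<^sub>0\<parallel>\<^sup>2\<close>; using each bound once leads to the one with \<open>\<parallel>u\<^sub>0\<parallel> \<parallel>\<partial>\<^sub>x u\<^sub>0\<parallel>\<close>.

  The function \<open>z = X\<^sup>t Y\<^sup>t u\<^sub>0\<close> satisfies \<open>z\<^sub>t - z\<^sub>x\<^sub>x = X\<^sup>t f(y)\<close> with \<open>y = Y\<^sup>t u\<^sub>0\<close>, so its defect
  is the Jensen gap \<open>X\<^sup>t f(y) - f(X\<^sup>t y)\<close>. By Taylor's formula the gap is at most \<open>M\<^sub>2 / 2\<close> times the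
  variance of \<open>y\<close> under the heat kernel. Since \<open>\<bar>y\<bar> \<le> \<kappa>\<close> and \<open>y\<close> is Lipschitz with constant
  \<open>exp (t M) \<parallel>\<partial>\<^sub>x u\<^sub>0\<parallel>\<close>, the variance is at most \<open>2 \<kappa> exp (t M) \<parallel>\<partial>\<^sub>x u\<^sub>0\<parallel>\<close> times the first absolute
  moment \<open>2 sqrt (t / \<pi>)\<close> of the kernel.

  The difference between \<open>T\<^sup>t u\<^sub>0\<close> and a product with defect at most \<open>h(t)\<close> is controlled by any
  \<open>H \<ge> 0\<close> with \<open>H' \<ge> M H + h\<close> (lemma \<open>parabolic_estimate\<close>), because all functions stay in \<open>[-\<kappa>,\<kappa>]\<close>
  (lemma \<open>reaction_diffusion_invariant_interval\<close>). Explicit choices of \<open>H\<close>, namely a power of \<open>t\<close> times an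
  exponential, give exactly the constants of the theorem. When \<open>\<parallel>\<partial>\<^sub>x u\<^sub>0\<parallel> = \<infinity>\<close>, the right-hand side is
  infinite unless its other factors vanish, and then the product is exact.
\<close>

section \<open>Comparison for parabolic equations on the line\<close>

lemma second_derivative_nonpos_at_max:
  fixes g :: "real \<Rightarrow> real"
  assumes max: "\<And>y. g y \<le> g x"
    and g': "\<And>y. (g has_real_derivative g' y) (at y)"
    and g'': "(g' has_real_derivative c) (at x)"
  shows "c \<le> 0"
proof (rule ccontr)
  assume "\<not> c \<le> 0"
  have "g' x = 0"
    using DERIV_local_max[OF g'[of x], of 1] max by auto
  then obtain \<delta> where "\<delta> > 0" and pos: "\<And>h. 0 < h \<Longrightarrow> h < \<delta> \<Longrightarrow> 0 < g' (x + h)"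
    using DERIV_pos_inc_right[OF g''] \<open>\<not> c \<le> 0\<close> by auto
  have "g x < g (x + \<delta>)"
  proof (rule DERIV_pos_imp_increasing_open[of x "x + \<delta>" g])
    show "x < x + \<delta>" using \<open>\<delta> > 0\<close> by simp
    show "\<exists>l. DERIV g y :> l \<and> l > 0" if "x < y" "y < x + \<delta>" for y
      using g'[of y] pos[of "y - x"] that by (intro exI[of _ "g' y"]) simp
    show "continuous_on {x..x + \<delta>} g"
      by (meson DERIV_isCont continuous_at_imp_continuous_on g')
  qed
  with max show False by (meson not_le)
qed

text \<open>
  The line is not compact, so a positive value of \<open>e\<close> is compared with the barrier
  \<open>\<epsilon> exp (K s) (1 + y\<^sup>2)\<close>, which exceeds the bounded function \<open>e\<close> for large \<open>\<bar>y\<bar>\<close>. At the first time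
  at which \<open>e\<close> touches the barrier, the difference has nonnegative time derivative and nonpositive second space
  derivative. This contradicts the differential inequality, as the barrier is a strict supersolution for
  \<open>K = M + 3\<close>.
\<close>

lemma parabolic_maximum_principle:
  fixes e et ex exx :: "real \<Rightarrow> real \<Rightarrow> real"
  assumes cont: "continuous_on ({0..\<tau>} \<times> UNIV) (\<lambda>(s, x). e s x)"
    and bdd: "\<And>s x. 0 \<le> s \<Longrightarrow> s \<le> \<tau> \<Longrightarrow> e s x \<le> B"
    and init: "\<And>x. e 0 x \<le> 0"
    and et: "\<And>s x. 0 < s \<Longrightarrow> s \<le> \<tau> \<Longrightarrow> ((\<lambda>s. e s x) has_real_derivative et s x) (at s)"
    and ex: "\<And>s x. 0 < s \<Longrightarrow> s \<le> \<tau> \<Longrightarrow> (e s has_real_derivative ex s x) (at x)"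
    and exx: "\<And>s x. 0 < s \<Longrightarrow> s \<le> \<tau> \<Longrightarrow> (ex s has_real_derivative exx s x) (at x)"
    and ineq: "\<And>s x. 0 < s \<Longrightarrow> s \<le> \<tau> \<Longrightarrow> 0 < e s x \<Longrightarrow> et s x - exx s x \<le> M * e s x"
    and "0 \<le> \<tau>"
  shows "e \<tau> x \<le> 0"
proof (rule ccontr)
  assume "\<not> e \<tau> x \<le> 0"
  define K where "K = M + 3"
  \<comment> \<open>With this \<open>\<epsilon>\<close> the barrier passes exactly through the positive value at \<open>(\<tau>, x)\<close>.\<close>
  define \<epsilon> where "\<epsilon> = e \<tau> x / (exp (K * \<tau>) * (1 + x\<^sup>2))"
  define \<Phi> where "\<Phi> s y = e s y - \<epsilon> * exp (K * s) * (1 + y\<^sup>2)" for s y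
  define S where "S = {p \<in> {0..\<tau>} \<times> UNIV. (\<lambda>(s, y). \<Phi> s y) p \<in> {0..}}"
  have sq: "1 + y\<^sup>2 > (0::real)" for y by (simp add: add_pos_nonneg)
  have "\<epsilon> > 0"
    using \<open>\<not> e \<tau> x \<le> 0\<close> sq by (auto simp: \<epsilon>_def)
  have "\<Phi> \<tau> x = 0"
    using sq[of x] by (auto simp: \<Phi>_def \<epsilon>_def)
  hence "(\<tau>, x) \<in> S"
    using \<open>0 \<le> \<tau>\<close> by (auto simp: S_def)
  have "compact S"
  proof (subst compact_eq_bounded_closed, intro conjI)
    have "continuous_on ({0..\<tau>} \<times> UNIV) (\<lambda>(s, y). \<Phi> s y)"
      using cont unfolding \<Phi>_def by (auto intro!: continuous_intros simp: case_prod_unfold)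
    thus "closed S"
      unfolding S_def using continuous_closed_preimage[of "{0..\<tau>} \<times> UNIV" "\<lambda>(s, y). \<Phi> s y" "{0..}"]
      by (simp add: closed_Times vimage_def Collect_conj_eq)
    define L where "L = exp (- \<bar>K\<bar> * \<tau>)"
    have "L > 0" by (simp add: L_def)
    have "\<bar>y\<bar> \<le> B / (\<epsilon> * L)" if "(s, y) \<in> S" for s y
    proof -
      have s: "0 \<le> s" "s \<le> \<tau>" and "\<Phi> s y \<ge> 0"
        using that by (auto simp: S_def)
      have "- \<bar>K\<bar> * \<tau> \<le> K * s"
      proof -
        have "- (K * s) \<le> \<bar>K\<bar> * s"
          using s by (metis abs_ge_minus_self abs_mult abs_of_nonneg)
        also have "\<dots> \<le> \<bar>K\<bar> * \<tau>" using s by (intro mult_left_mono) auto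
        finally show ?thesis by simp
      qed
      hence "L \<le> exp (K * s)" by (simp add: L_def)
      have "\<bar>y\<bar> \<le> 1 + y\<^sup>2"
        using sum_squares_bound[of "\<bar>y\<bar>" 1] by (simp add: power2_eq_square)
      have "\<epsilon> * L * \<bar>y\<bar> \<le> \<epsilon> * exp (K * s) * (1 + y\<^sup>2)"
        using \<open>L \<le> _\<close> \<open>\<bar>y\<bar> \<le> _\<close> \<open>\<epsilon> > 0\<close> \<open>L > 0\<close> by (intro mult_mono) auto
      also have "\<dots> \<le> B"
        using \<open>\<Phi> s y \<ge> 0\<close> bdd[OF s, of y] by (simp add: \<Phi>_def)
      finally show ?thesis
        using \<open>\<epsilon> > 0\<close> \<open>L > 0\<close> by (simp add: field_simps)
    qed
    hence "S \<subseteq> {0..\<tau>} \<times> {-(B / (\<epsilon> * L))..B / (\<epsilon> * L)}"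
      by (fastforce simp: S_def abs_le_iff)
    thus "bounded S"
      by (rule bounded_subset[rotated]) (intro bounded_Times bounded_closed_interval)
  qed
  \<comment> \<open>\<open>fst p\<close> is the first time at which \<open>\<Phi>\<close> is nonnegative somewhere.\<close>
  then obtain p where "p \<in> S" and min: "\<And>q. q \<in> S \<Longrightarrow> fst p \<le> fst q"
    using continuous_attains_inf[of S fst] \<open>(\<tau>, x) \<in> S\<close> continuous_on_fst[OF continuous_on_id, of S]
    by (metis empty_iff)
  define t0 x0 where "t0 = fst p" and "x0 = snd p"
  have t0: "0 \<le> t0" "t0 \<le> \<tau>" and \<Phi>0: "\<Phi> t0 x0 \<ge> 0"
    using \<open>p \<in> S\<close> by (auto simp: S_def t0_def x0_def)
  have before: "\<Phi> s y < 0" if "0 \<le> s" "s < t0" for s y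
    using min[of "(s, y)"] that t0 by (force simp: S_def t0_def)
  have "t0 \<noteq> 0"
  proof
    assume "t0 = 0"
    thus False
      using \<Phi>0 init[of x0] \<open>\<epsilon> > 0\<close> sq[of x0] mult_pos_pos[OF \<open>\<epsilon> > 0\<close> sq[of x0]]
      by (simp add: \<Phi>_def)
  qed
  hence "t0 > 0" using t0 by simp
  define E where "E = \<epsilon> * exp (K * t0)"
  have "E > 0" using \<open>\<epsilon> > 0\<close> by (simp add: E_def)
  have dt: "((\<lambda>s. \<Phi> s y) has_real_derivative et t0 y - K * E * (1 + y\<^sup>2)) (at t0)" for y
    unfolding \<Phi>_def E_def
    by (rule derivative_eq_intros et refl | use \<open>t0 > 0\<close> t0 in simp)+
  have dx: "(\<Phi> t0 has_real_derivative ex t0 y - 2 * E * y) (at y)" for y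
    unfolding \<Phi>_def E_def
    by (rule derivative_eq_intros ex refl | use \<open>t0 > 0\<close> t0 in simp)+
  have dxx: "((\<lambda>y. ex t0 y - 2 * E * y) has_real_derivative exx t0 y - 2 * E) (at y)" for y
    by (rule derivative_eq_intros exx refl | use \<open>t0 > 0\<close> t0 in simp)+
  have "\<Phi> t0 y \<le> 0" for y
  proof (rule tendsto_upperbound)
    show "((\<lambda>s. \<Phi> s y) \<longlongrightarrow> \<Phi> t0 y) (at_left t0)"
      using DERIV_isCont[OF dt[of y]] by (simp add: isCont_def filterlim_at_split)
    show "\<forall>\<^sub>F s in at_left t0. \<Phi> s y \<le> 0"
      unfolding eventually_at_left_field using before \<open>t0 > 0\<close>
      by (intro exI[of _ 0]) (auto simp: less_imp_le)
  qed simp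
  with \<Phi>0 have "\<Phi> t0 x0 = 0" and max: "\<And>y. \<Phi> t0 y \<le> \<Phi> t0 x0"
    by (auto intro: antisym order_trans)
  have "et t0 x0 - K * E * (1 + x0\<^sup>2) \<ge> 0"
  proof (rule ccontr)
    assume "\<not> ?thesis"
    then obtain \<delta> where "\<delta> > 0" and dec: "\<And>h. 0 < h \<Longrightarrow> h < \<delta> \<Longrightarrow> \<Phi> t0 x0 < \<Phi> (t0 - h) x0"
      using DERIV_neg_dec_left[OF dt[of x0]] by auto
    define h where "h = min (\<delta> / 2) t0"
    have "0 < h" "h < \<delta>" "h \<le> t0" using \<open>\<delta> > 0\<close> \<open>t0 > 0\<close> by (auto simp: h_def)
    thus False using dec[of h] before[of "t0 - h" x0] \<Phi>0 by simp
  qed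
  moreover have "exx t0 x0 - 2 * E \<le> 0"
    using second_derivative_nonpos_at_max[OF max dx dxx] .
  moreover have e0: "e t0 x0 = E * (1 + x0\<^sup>2)"
    using \<open>\<Phi> t0 x0 = 0\<close> by (simp add: \<Phi>_def E_def)
  have "0 < e t0 x0" unfolding e0 using \<open>E > 0\<close> sq by simp
  from ineq[OF \<open>t0 > 0\<close> t0(2) this]
  have "et t0 x0 - exx t0 x0 \<le> M * E * (1 + x0\<^sup>2)" by (simp add: e0)
  moreover have "E * (1 + x0\<^sup>2) \<ge> E" using \<open>E > 0\<close> by (simp add: algebra_simps)
  moreover have "K * E * (1 + x0\<^sup>2) = M * E * (1 + x0\<^sup>2) + 3 * (E * (1 + x0\<^sup>2))"
    by (simp add: K_def algebra_simps)
  ultimately show False using \<open>E > 0\<close> by linarith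
qed

text \<open>
  A linear Gronwall inequality in the sup norm: \<open>\<plusminus> d - H\<close> satisfies the hypotheses of the maximum principle.
  The condition on \<open>g\<close> says that \<open>H\<close> is a supersolution of \<open>H' = M H + \<bar>g\<bar>\<close>; leaving \<open>H\<close> free
  avoids integrals of exponentials and lets each application take a closed form.
\<close>

lemma parabolic_estimate:
  fixes d dt dx dxx p g :: "real \<Rightarrow> real \<Rightarrow> real"
  assumes cont: "continuous_on ({0..\<tau>} \<times> UNIV) (\<lambda>(s, x). d s x)"
    and bdd: "\<And>s x. 0 \<le> s \<Longrightarrow> s \<le> \<tau> \<Longrightarrow> \<bar>d s x\<bar> \<le> B"
    and dt: "\<And>s x. 0 < s \<Longrightarrow> s \<le> \<tau> \<Longrightarrow> ((\<lambda>s. d s x) has_real_derivative dt s x) (at s)"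
    and dx: "\<And>s x. 0 < s \<Longrightarrow> s \<le> \<tau> \<Longrightarrow> (d s has_real_derivative dx s x) (at x)"
    and dxx: "\<And>s x. 0 < s \<Longrightarrow> s \<le> \<tau> \<Longrightarrow> (dx s has_real_derivative dxx s x) (at x)"
    and eq: "\<And>s x. 0 < s \<Longrightarrow> s \<le> \<tau> \<Longrightarrow> dt s x - dxx s x = p s x + g s x"
    and p: "\<And>s x. 0 < s \<Longrightarrow> s \<le> \<tau> \<Longrightarrow> \<bar>p s x\<bar> \<le> M * \<bar>d s x\<bar>"
    and g: "\<And>s x. 0 < s \<Longrightarrow> s \<le> \<tau> \<Longrightarrow> \<bar>g s x\<bar> \<le> H' s - M * H s"
    and contH: "continuous_on {0..\<tau>} H"
    and H': "\<And>s. 0 < s \<Longrightarrow> s \<le> \<tau> \<Longrightarrow> (H has_real_derivative H' s) (at s)"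
    and H: "\<And>s. 0 \<le> s \<Longrightarrow> s \<le> \<tau> \<Longrightarrow> 0 \<le> H s"
    and init: "\<And>x. \<bar>d 0 x\<bar> \<le> H 0"
    and "0 \<le> \<tau>"
  shows "\<bar>d \<tau> x\<bar> \<le> H \<tau>"
proof -
  have "\<sigma> * d \<tau> x - H \<tau> \<le> 0" if "\<bar>\<sigma>\<bar> = 1" for \<sigma>
  proof (rule parabolic_maximum_principle[where e = "\<lambda>s x. \<sigma> * d s x - H s" and \<tau> = \<tau> and B = B and M = M
        and et = "\<lambda>s x. \<sigma> * dt s x - H' s" and ex = "\<lambda>s x. \<sigma> * dx s x" and exx = "\<lambda>s x. \<sigma> * dxx s x"])
    have \<sigma>: "\<sigma> * y \<le> \<bar>y\<bar>" for y
      using that by (metis abs_ge_self abs_mult mult_1)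
    show "continuous_on ({0..\<tau>} \<times> UNIV) (\<lambda>(s, x). \<sigma> * d s x - H s)"
      using cont unfolding case_prod_unfold
      by (auto intro!: continuous_intros continuous_on_compose2[OF contH])
    show "\<sigma> * d s x - H s \<le> B" if "0 \<le> s" "s \<le> \<tau>" for s x
      using \<sigma>[of "d s x"] bdd[OF that, of x] H[OF that] by linarith
    show "\<sigma> * d 0 x - H 0 \<le> 0" for x
      using \<sigma>[of "d 0 x"] init[of x] by linarith
    fix s x assume s: "0 < s" "s \<le> \<tau>"
    show "((\<lambda>s. \<sigma> * d s x - H s) has_real_derivative \<sigma> * dt s x - H' s) (at s)"
      by (rule derivative_eq_intros dt H' s refl | simp)+
    show "((\<lambda>x. \<sigma> * d s x - H s) has_real_derivative \<sigma> * dx s x) (at x)"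
      by (rule derivative_eq_intros dx s refl | simp)+
    show "((\<lambda>x. \<sigma> * dx s x) has_real_derivative \<sigma> * dxx s x) (at x)"
      by (rule derivative_eq_intros dxx s refl | simp)+
    assume pos: "0 < \<sigma> * d s x - H s"
    have "\<bar>d s x\<bar> = \<bar>\<sigma> * d s x\<bar>" using that by (simp add: abs_mult)
    also have "\<dots> = \<sigma> * d s x" using pos H[of s] s by simp
    finally have "\<bar>d s x\<bar> = \<sigma> * d s x" .
    hence "\<sigma> * p s x \<le> M * (\<sigma> * d s x)" 
      using \<sigma>[of "p s x"] p[OF s, of x] by simp
    moreover have "\<sigma> * dt s x - \<sigma> * dxx s x = \<sigma> * p s x + \<sigma> * g s x"
      using eq[OF s, of x] by (metis distrib_left right_diff_distrib)
    ultimately show "\<sigma> * dt s x - H' s - \<sigma> * dxx s x \<le> M * (\<sigma> * d s x - H s)"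
      using \<sigma>[of "g s x"] g[OF s, of x] by (simp add: right_diff_distrib)
  qed fact
  from this[of 1] this[of "-1"] show ?thesis by auto
qed

section \<open>Calculus of remainders\<close>

lemma has_derivative_at_if_within_nonneg:
  fixes y :: "real \<Rightarrow> real"
  assumes "(y has_real_derivative D) (at s within {0..})" "0 < s"
  shows "(y has_real_derivative D) (at s)"
  using assms at_within_interior[of s "{0..}"] by (simp add: interior_real_atLeast)

text \<open>
  The remainder is compared with the increment of a curve \<open>v\<close> rather than with \<open>s - t\<close>, so that the lemma
  also applies to derivatives along \<open>v\<close>.
\<close>

lemma derivative_zero_if_quadratic:
  fixes R v :: "real \<Rightarrow> real"
  assumes v: "(v has_real_derivative v') (at t)"
    and R: "\<forall>\<^sub>F s in nhds t. \<bar>R s\<bar> \<le> C * (v s - v t)\<^sup>2"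
  shows "(R has_real_derivative 0) (at t)"
proof -
  have "R t = 0"
    using eventually_nhds_x_imp_x[OF R] by simp
  have "((\<lambda>s. (R s - R t) / (s - t)) \<longlongrightarrow> 0) (at t)"
  proof (rule Lim_null_comparison)
    show "\<forall>\<^sub>F s in at t. norm ((R s - R t) / (s - t)) \<le> C * (\<bar>(v s - v t) / (s - t)\<bar> * \<bar>v s - v t\<bar>)"
      using R unfolding eventually_at_filter
    proof eventually_elim
      case (elim s)
      show ?case
      proof (intro impI)
        assume "s \<noteq> t"
        hence "\<bar>R s\<bar> / \<bar>s - t\<bar> \<le> C * (v s - v t)\<^sup>2 / \<bar>s - t\<bar>"
          using elim by (intro divide_right_mono) auto
        thus "norm ((R s - R t) / (s - t)) \<le> C * (\<bar>(v s - v t) / (s - t)\<bar> * \<bar>v s - v t\<bar>)"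
          by (simp add: \<open>R t = 0\<close> abs_divide power2_eq_square flip: abs_mult)
      qed
    qed
    have "((\<lambda>s. v s - v t) \<longlongrightarrow> v t - v t) (at t)"
      using DERIV_isCont[OF v] unfolding isCont_def by (rule tendsto_diff) simp
    moreover have "((\<lambda>s. (v s - v t) / (s - t)) \<longlongrightarrow> v') (at t)"
      using v by (simp add: has_field_derivative_iff)
    ultimately have "((\<lambda>s. C * (\<bar>(v s - v t) / (s - t)\<bar> * \<bar>v s - v t\<bar>)) \<longlongrightarrow> C * (\<bar>v'\<bar> * \<bar>v t - v t\<bar>)) (at t)"
      by (intro tendsto_mult tendsto_rabs tendsto_const)
    thus "((\<lambda>s. C * (\<bar>(v s - v t) / (s - t)\<bar> * \<bar>v s - v t\<bar>)) \<longlongrightarrow> 0) (at t)" by simp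
  qed
  thus ?thesis by (simp add: has_field_derivative_iff)
qed

lemma has_derivative_if_quadratic_remainder:
  fixes g :: "real \<Rightarrow> real"
  assumes "\<And>a. \<bar>a - r\<bar> < 1 \<Longrightarrow> \<bar>g a - g r - D * (a - r)\<bar> \<le> C * (a - r)\<^sup>2"
  shows "(g has_real_derivative D) (at r)"
proof -
  define R where "R a = g a - g r - D * (a - r)" for a
  have "\<forall>\<^sub>F a in nhds r. \<bar>a - r\<bar> < 1"
    using eventually_nhds_metric[of "\<lambda>a. \<bar>a - r\<bar> < 1" r] by (auto simp: dist_real_def intro!: exI[of _ 1])
  hence "\<forall>\<^sub>F a in nhds r. \<bar>R a\<bar> \<le> C * (a - r)\<^sup>2"
    by eventually_elim (simp add: R_def assms)
  hence "(R has_real_derivative 0) (at r)"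
    using derivative_zero_if_quadratic[of "\<lambda>a. a" 1 r R C] by simp
  hence "((\<lambda>a. R a + g r + D * (a - r)) has_real_derivative D) (at r)"
    by (auto intro!: derivative_eq_intros)
  thus ?thesis by (simp add: R_def)
qed

lemma first_order_taylor_bound:
  fixes g :: "real \<Rightarrow> real"
  assumes g1: "\<And>r. (g has_real_derivative g1 r) (at r)"
    and g2: "\<And>r. (g1 has_real_derivative g2 r) (at r)"
    and bound: "\<And>r. \<bar>r\<bar> \<le> K \<Longrightarrow> \<bar>g2 r\<bar> \<le> M"
    and "\<bar>a\<bar> \<le> K" "\<bar>b\<bar> \<le> K"
  shows "\<bar>g b - g a - g1 a * (b - a)\<bar> \<le> M / 2 * (b - a)\<^sup>2"
proof (cases "b = a")
  case False
  define diff where "diff n = (if n = 0 then g else if n = 1 then g1 else g2)" for n :: nat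
  have "\<exists>t. (if b < a then b < t \<and> t < a else a < t \<and> t < b) \<and>
      g b = (\<Sum>m<2. diff m a / fact m * (b - a) ^ m) + diff 2 t / fact 2 * (b - a) ^ 2"
  proof (rule Taylor)
    show "\<forall>m t. m < 2 \<and> -K \<le> t \<and> t \<le> K \<longrightarrow> DERIV (diff m) t :> diff (Suc m) t"
      using g1 g2 by (auto simp: diff_def less_2_cases_iff)
  qed (use assms False in \<open>auto simp: diff_def\<close>)
  then obtain t where t: "\<bar>t\<bar> \<le> K"
    and eq: "g b = (\<Sum>m<2. diff m a / fact m * (b - a) ^ m) + diff 2 t / fact 2 * (b - a) ^ 2"
    using assms(4,5) by (smt (verit) abs_le_iff)
  have "g b - g a - g1 a * (b - a) = g2 t / 2 * (b - a)\<^sup>2"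
    using eq by (simp add: diff_def numeral_2_eq_2)
  hence "\<bar>g b - g a - g1 a * (b - a)\<bar> = \<bar>g2 t\<bar> / 2 * (b - a)\<^sup>2"
    by (simp only: abs_mult abs_divide) simp
  also have "\<dots> \<le> M / 2 * (b - a)\<^sup>2"
    using bound[OF t] by (intro mult_right_mono) auto
  finally show ?thesis .
qed simp

lemma lipschitz_bound_on_interval:
  fixes g :: "real \<Rightarrow> real"
  assumes g1: "\<And>r. (g has_real_derivative g1 r) (at r)"
    and bound: "\<And>r. \<bar>r\<bar> \<le> K \<Longrightarrow> \<bar>g1 r\<bar> \<le> M"
    and "\<bar>a\<bar> \<le> K" "\<bar>b\<bar> \<le> K"
  shows "\<bar>g a - g b\<bar> \<le> M * \<bar>a - b\<bar>"
proof -
  have "norm (g a - g b) \<le> M * norm (a - b)"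
    by (rule field_differentiable_bound[of "{-K..K}"])
      (use assms in \<open>auto intro: has_field_derivative_at_within\<close>)
  thus ?thesis by simp
qed

lemma continuous_on_interval_bounded:
  fixes g :: "real \<Rightarrow> real"
  assumes "continuous_on {a..b} g"
  obtains B where "0 \<le> B" "\<And>s. a \<le> s \<Longrightarrow> s \<le> b \<Longrightarrow> \<bar>g s\<bar> \<le> B"
proof -
  have "bounded (g ` {a..b})"
    using assms by (intro compact_imp_bounded compact_continuous_image) auto
  then obtain B where "\<forall>s\<in>{a..b}. \<bar>g s\<bar> \<le> B"
    by (auto simp: bounded_iff)
  hence "0 \<le> max B 0" "\<And>s. a \<le> s \<Longrightarrow> s \<le> b \<Longrightarrow> \<bar>g s\<bar> \<le> max B 0"
    by (auto intro: max.coboundedI1)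
  thus thesis using that by blast
qed

section \<open>Comparison for ordinary differential equations and invariant intervals\<close>

text \<open>
  Functions of time alone solve the parabolic problem with vanishing space derivatives.
\<close>

lemma ode_estimate:
  fixes y p g H H' :: "real \<Rightarrow> real"
  assumes y: "\<And>s. 0 \<le> s \<Longrightarrow> (y has_real_derivative p s + g s) (at s within {0..})"
    and p: "\<And>s. 0 < s \<Longrightarrow> s \<le> \<tau> \<Longrightarrow> \<bar>p s\<bar> \<le> M * \<bar>y s\<bar>"
    and g: "\<And>s. 0 < s \<Longrightarrow> s \<le> \<tau> \<Longrightarrow> \<bar>g s\<bar> \<le> H' s - M * H s"
    and H': "\<And>s. (H has_real_derivative H' s) (at s)"
    and H: "\<And>s. 0 \<le> s \<Longrightarrow> s \<le> \<tau> \<Longrightarrow> 0 \<le> H s"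
    and init: "\<bar>y 0\<bar> \<le> H 0"
    and "0 \<le> \<tau>"
  shows "\<bar>y \<tau>\<bar> \<le> H \<tau>"
proof -
  have "continuous_on {0..} y"
    unfolding continuous_on_eq_continuous_within using y by (auto intro: DERIV_continuous)
  hence cont: "continuous_on {0..\<tau>} y" by (rule continuous_on_subset) auto
  then obtain B where B: "\<And>s. 0 \<le> s \<Longrightarrow> s \<le> \<tau> \<Longrightarrow> \<bar>y s\<bar> \<le> B"
    using continuous_on_interval_bounded by blast
  show ?thesis
  proof (rule parabolic_estimate[where d = "\<lambda>s x. y s" and dt = "\<lambda>s x. p s + g s" and dx = "\<lambda>s x. 0"
        and dxx = "\<lambda>s x. 0" and p = "\<lambda>s x. p s" and g = "\<lambda>s x. g s" and M = M and H = H and H' = H' and B = B and x = 0])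
    show "continuous_on ({0..\<tau>} \<times> (UNIV :: real set)) (\<lambda>(s, x). y s)"
      unfolding case_prod_unfold by (rule continuous_on_compose2[OF cont continuous_on_fst[OF continuous_on_id]]) auto
    show "continuous_on {0..\<tau>} H"
      by (meson DERIV_isCont H' continuous_at_imp_continuous_on)
  qed (use assms B in \<open>auto intro: has_derivative_at_if_within_nonneg\<close>)
qed

text \<open>
  Where \<open>\<bar>d\<bar> > K \<ge> 1\<close>, the reaction term points back towards \<open>[-K, K]\<close>, so the maximum principle applies to
  \<open>\<plusminus> d - K\<close>.
\<close>

lemma reaction_diffusion_invariant_interval:
  fixes d dt dx dxx :: "real \<Rightarrow> real \<Rightarrow> real"
  assumes dissip: "\<And>r. 1 \<le> \<bar>r\<bar> \<Longrightarrow> r * f r \<le> 0"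
    and cont: "continuous_on ({0..\<tau>} \<times> UNIV) (\<lambda>(s, x). d s x)"
    and bdd: "\<And>s x. 0 \<le> s \<Longrightarrow> s \<le> \<tau> \<Longrightarrow> \<bar>d s x\<bar> \<le> B"
    and dt: "\<And>s x. 0 < s \<Longrightarrow> s \<le> \<tau> \<Longrightarrow> ((\<lambda>s. d s x) has_real_derivative dt s x) (at s)"
    and dx: "\<And>s x. 0 < s \<Longrightarrow> s \<le> \<tau> \<Longrightarrow> (d s has_real_derivative dx s x) (at x)"
    and dxx: "\<And>s x. 0 < s \<Longrightarrow> s \<le> \<tau> \<Longrightarrow> (dx s has_real_derivative dxx s x) (at x)"
    and eq: "\<And>s x. 0 < s \<Longrightarrow> s \<le> \<tau> \<Longrightarrow> dt s x - dxx s x = f (d s x)"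
    and init: "\<And>x. \<bar>d 0 x\<bar> \<le> K"
    and "1 \<le> K" "0 \<le> \<tau>"
  shows "\<bar>d \<tau> x\<bar> \<le> K"
proof -
  have "\<sigma> * d \<tau> x - K \<le> 0" if "\<bar>\<sigma>\<bar> = 1" for \<sigma>
  proof (rule parabolic_maximum_principle[where e = "\<lambda>s x. \<sigma> * d s x - K" and \<tau> = \<tau> and B = "B - K" and M = 0
        and et = "\<lambda>s x. \<sigma> * dt s x" and ex = "\<lambda>s x. \<sigma> * dx s x" and exx = "\<lambda>s x. \<sigma> * dxx s x"])
    have \<sigma>: "\<sigma> * y \<le> \<bar>y\<bar>" for y
      using that by (metis abs_ge_self abs_mult mult_1)
    show "continuous_on ({0..\<tau>} \<times> UNIV) (\<lambda>(s, x). \<sigma> * d s x - K)"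
      using cont unfolding case_prod_unfold by (auto intro!: continuous_intros)
    show "\<sigma> * d s x - K \<le> B - K" if "0 \<le> s" "s \<le> \<tau>" for s x
      using \<sigma>[of "d s x"] bdd[OF that, of x] by linarith
    show "\<sigma> * d 0 x - K \<le> 0" for x
      using \<sigma>[of "d 0 x"] init[of x] by linarith
    fix s x assume s: "0 < s" "s \<le> \<tau>"
    show "((\<lambda>s. \<sigma> * d s x - K) has_real_derivative \<sigma> * dt s x) (at s)"
      by (rule derivative_eq_intros dt s refl | simp)+
    show "((\<lambda>x. \<sigma> * d s x - K) has_real_derivative \<sigma> * dx s x) (at x)"
      by (rule derivative_eq_intros dx s refl | simp)+
    show "((\<lambda>x. \<sigma> * dx s x) has_real_derivative \<sigma> * dxx s x) (at x)"
      by (rule derivative_eq_intros dxx s refl | simp)+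
    assume pos: "0 < \<sigma> * d s x - K"
    have "1 \<le> \<bar>d s x\<bar>" using \<sigma>[of "d s x"] pos \<open>1 \<le> K\<close> by linarith
    have "(\<sigma> * d s x) * (\<sigma> * f (d s x)) = (\<sigma> * \<sigma>) * (d s x * f (d s x))" by (simp add: mult_ac)
    moreover have "\<sigma> * \<sigma> = 1" using that by (metis abs_mult_self_eq mult_1)
    ultimately have "(\<sigma> * d s x) * (\<sigma> * f (d s x)) \<le> 0"
      using dissip[OF \<open>1 \<le> \<bar>d s x\<bar>\<close>] by (simp only: mult_1)
    hence "\<sigma> * f (d s x) \<le> 0"
      using pos \<open>1 \<le> K\<close> mult_pos_pos[of "\<sigma> * d s x" "\<sigma> * f (d s x)"] by linarith
    thus "\<sigma> * dt s x - \<sigma> * dxx s x \<le> 0 * (\<sigma> * d s x - K)"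
      using eq[OF s, of x] by (simp flip: right_diff_distrib)
  qed fact
  from this[of 1] this[of "-1"] show ?thesis by auto
qed

lemma bound_on_interval:
  assumes "continuous_on UNIV (g :: real \<Rightarrow> real)"
  obtains M where "0 \<le> M" "\<And>r. \<bar>r\<bar> \<le> K \<Longrightarrow> \<bar>g r\<bar> \<le> M"
proof -
  have "continuous_on {-K..K} g" using assms by (rule continuous_on_subset) simp
  then obtain M where "0 \<le> M" "\<And>r. -K \<le> r \<Longrightarrow> r \<le> K \<Longrightarrow> \<bar>g r\<bar> \<le> M"
    using continuous_on_interval_bounded by blast
  thus thesis using that[of M] by auto
qed

section \<open>The flow of the reaction equation and its derivatives\<close>

locale dissipative_reaction =
  fixes f f1 f2 f3 :: "real \<Rightarrow> real"
  assumes f1: "\<And>r. (f has_real_derivative f1 r) (at r)"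
    and f2: "\<And>r. (f1 has_real_derivative f2 r) (at r)"
    and f3: "\<And>r. (f2 has_real_derivative f3 r) (at r)"
    and continuous_f3: "continuous_on UNIV f3"
    and dissip: "\<And>r. 1 \<le> \<bar>r\<bar> \<Longrightarrow> r * f r \<le> 0"
begin

definition solves :: "(real \<Rightarrow> real) \<Rightarrow> bool" where
  "solves y \<longleftrightarrow> (\<forall>t\<ge>0. (y has_real_derivative f (y t)) (at t within {0..}))"

lemma continuous_f1: "continuous_on S f1" and continuous_f2: "continuous_on S f2"
  by (meson DERIV_isCont continuous_at_imp_continuous_on f2 f3)+

lemma solves_continuous:
  assumes "solves y" shows "continuous_on {0..} y"
  using assms unfolding solves_def continuous_on_eq_continuous_within by (auto intro: DERIV_continuous)

lemma solves_at: "solves y \<Longrightarrow> 0 < t \<Longrightarrow> (y has_real_derivative f (y t)) (at t)"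
  unfolding solves_def by (simp add: has_derivative_at_if_within_nonneg)

lemma solves_abs_le:
  assumes "solves y" "\<bar>y 0\<bar> \<le> K" "1 \<le> K" "0 \<le> t"
  shows "\<bar>y t\<bar> \<le> K"
proof -
  have cont: "continuous_on {0..t} y"
    using solves_continuous[OF assms(1)] by (rule continuous_on_subset) auto
  then obtain B where B: "\<And>s. 0 \<le> s \<Longrightarrow> s \<le> t \<Longrightarrow> \<bar>y s\<bar> \<le> B"
    using continuous_on_interval_bounded by blast
  show ?thesis
  proof (rule reaction_diffusion_invariant_interval[where d = "\<lambda>s x. y s" and dt = "\<lambda>s x. f (y s)" and dx = "\<lambda>s x. 0"
        and dxx = "\<lambda>s x. 0" and f = f and B = B and x = 0])
    show "continuous_on ({0..t} \<times> (UNIV :: real set)) (\<lambda>(s, x). y s)"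
      unfolding case_prod_unfold by (rule continuous_on_compose2[OF cont continuous_on_fst[OF continuous_on_id]]) auto
  qed (use assms B dissip in \<open>auto intro: solves_at\<close>)
qed

lemma solves_diff_le:
  assumes y: "solves y" "\<bar>y 0\<bar> \<le> K" and z: "solves z" "\<bar>z 0\<bar> \<le> K"
    and "1 \<le> K" and M: "\<And>r. \<bar>r\<bar> \<le> K \<Longrightarrow> \<bar>f1 r\<bar> \<le> M" and "0 \<le> t"
  shows "\<bar>y t - z t\<bar> \<le> exp (M * t) * \<bar>y 0 - z 0\<bar>"
proof (rule ode_estimate[where y = "\<lambda>s. y s - z s" and p = "\<lambda>s. f (y s) - f (z s)" and g = "\<lambda>s. 0"
      and H = "\<lambda>s. exp (M * s) * \<bar>y 0 - z 0\<bar>" and H' = "\<lambda>s. M * (exp (M * s) * \<bar>y 0 - z 0\<bar>)" and M = M])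
  show "((\<lambda>s. y s - z s) has_real_derivative f (y s) - f (z s) + 0) (at s within {0..})" if "0 \<le> s" for s
    using y z that by (auto simp: solves_def intro!: derivative_eq_intros)
  show "\<bar>f (y s) - f (z s)\<bar> \<le> M * \<bar>y s - z s\<bar>" if "0 < s" for s
  proof (rule lipschitz_bound_on_interval[OF f1])
    show "\<bar>y s\<bar> \<le> K" "\<bar>z s\<bar> \<le> K"
      using solves_abs_le y z \<open>1 \<le> K\<close> that by auto
  qed (rule M)
  show "((\<lambda>s. exp (M * s) * \<bar>y 0 - z 0\<bar>) has_real_derivative M * (exp (M * s) * \<bar>y 0 - z 0\<bar>)) (at s)" for s
    by (auto intro!: derivative_eq_intros)
qed (use \<open>0 \<le> t\<close> in auto)

lemma solves_unique:
  assumes "solves y" "solves z" "y 0 = z 0" "0 \<le> t"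
  shows "y t = z t"
proof -
  define K where "K = max 1 \<bar>y 0\<bar>"
  obtain M where "\<And>r. \<bar>r\<bar> \<le> K \<Longrightarrow> \<bar>f1 r\<bar> \<le> M"
    using bound_on_interval[OF continuous_f1] by blast
  from solves_diff_le[of y K z, OF _ _ _ _ _ this \<open>0 \<le> t\<close>] assms
  show ?thesis by (auto simp: K_def)
qed

end

text \<open>
  The flow is indexed by the initial value. Its derivatives \<open>\<phi>\<^sub>r\<close> and \<open>\<phi>\<^sub>r\<^sub>r\<close> in that value are obtained below
  from explicit candidates by bounding the remainders quadratically.
\<close>

locale dissipative_flow = dissipative_reaction +
  fixes \<phi> :: "real \<Rightarrow> real \<Rightarrow> real"
  assumes flow_0: "\<phi> 0 r = r"
    and flow_solves: "solves (\<lambda>t. \<phi> t r)"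
begin

lemma flow_continuous: "continuous_on {0..} (\<lambda>t. \<phi> t r)"
  by (rule solves_continuous[OF flow_solves])

lemma flow_abs_le: "\<bar>r\<bar> \<le> K \<Longrightarrow> 1 \<le> K \<Longrightarrow> 0 \<le> t \<Longrightarrow> \<bar>\<phi> t r\<bar> \<le> K"
  using solves_abs_le[OF flow_solves, of r K t] by (simp add: flow_0)

lemma flow_diff_le:
  assumes "\<bar>a\<bar> \<le> K" "\<bar>b\<bar> \<le> K" "1 \<le> K" "\<And>r. \<bar>r\<bar> \<le> K \<Longrightarrow> \<bar>f1 r\<bar> \<le> M" "0 \<le> t"
  shows "\<bar>\<phi> t a - \<phi> t b\<bar> \<le> exp (M * t) * \<bar>a - b\<bar>"
  using solves_diff_le[OF flow_solves _ flow_solves, of a K b M t] assms by (simp add: flow_0)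

text \<open>
  The solution of the linearised equation \<open>j' = f'(\<phi>) j\<close>, \<open>j(0) = 1\<close>; it turns out to be
  \<open>\<phi>\<^sub>r(t, r)\<close>.
\<close>

definition jacobian :: "real \<Rightarrow> real \<Rightarrow> real" where
  "jacobian t r = exp (integral {0..t} (\<lambda>s. f1 (\<phi> s r)))"

lemma continuous_f1_flow: "continuous_on {0..t} (\<lambda>s. f1 (\<phi> s r))"
  and continuous_f2_flow: "continuous_on {0..t} (\<lambda>s. f2 (\<phi> s r))"
  using flow_continuous[of r]
  by (auto intro!: continuous_on_compose2[OF continuous_f1[of UNIV]] continuous_on_compose2[OF continuous_f2[of UNIV]]
      intro: continuous_on_subset)

lemma jacobian_time_derivative:
  assumes "0 \<le> t"
  shows "((\<lambda>s. jacobian s r) has_real_derivative f1 (\<phi> t r) * jacobian t r) (at t within {0..})"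
proof -
  have "((\<lambda>s. integral {0..s} (\<lambda>s. f1 (\<phi> s r))) has_real_derivative f1 (\<phi> t r)) (at t within {0..t+1})"
    using assms by (intro integral_has_real_derivative continuous_f1_flow) auto
  moreover have "at t within {0..t+1} = at t within {0..}"
    by (rule at_within_nhd[of _ "{..<t+1}"]) auto
  ultimately show ?thesis
    unfolding jacobian_def by (auto intro!: derivative_eq_intros)
qed

lemma continuous_jacobian: "continuous_on {0..t} (\<lambda>s. jacobian s r)"
proof (rule continuous_on_subset)
  show "continuous_on {0..} (\<lambda>s. jacobian s r)"
    unfolding continuous_on_eq_continuous_within
    using jacobian_time_derivative by (auto intro: DERIV_continuous)
qed auto

lemma jacobian_le:
  assumes "\<bar>r\<bar> \<le> K" "1 \<le> K" "\<And>r. \<bar>r\<bar> \<le> K \<Longrightarrow> \<bar>f1 r\<bar> \<le> M" "0 \<le> t"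
  shows "jacobian t r \<le> exp (M * t)"
proof -
  have "norm (integral {0..t} (\<lambda>s. f1 (\<phi> s r))) \<le> M * (t - 0)"
    using assms flow_abs_le by (intro integral_bound continuous_f1_flow) auto
  thus ?thesis by (auto simp: jacobian_def)
qed

lemma jacobian_pos: "0 < jacobian t r" by (simp add: jacobian_def)

text \<open>
  The remainder \<open>\<phi>(t,a) - \<phi>(t,r) - \<phi>\<^sub>r(t,r) (a - r)\<close> solves the linearised equation with a forcing term
  that is the Taylor remainder of \<open>f\<close>, hence at most \<open>M\<^sub>2 / 2 exp (2 M t) (a - r)\<^sup>2\<close>. The bound is locally
  uniform in \<open>t\<close>, which makes it usable along curves as well.
\<close>

lemma flow_quadratic_remainder:
  assumes "\<bar>a\<bar> \<le> K" "\<bar>r\<bar> \<le> K" "1 \<le> K"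
    and M: "\<And>r. \<bar>r\<bar> \<le> K \<Longrightarrow> \<bar>f1 r\<bar> \<le> M" and M2: "\<And>r. \<bar>r\<bar> \<le> K \<Longrightarrow> \<bar>f2 r\<bar> \<le> M2" and "0 \<le> t"
  shows "\<bar>\<phi> t a - \<phi> t r - jacobian t r * (a - r)\<bar> \<le> M2 / 2 * t * exp (2 * M * t) * (a - r)\<^sup>2"
proof -
  have "0 \<le> M" "0 \<le> M2" using M[of 0] M2[of 0] \<open>1 \<le> K\<close> by auto
  define c where "c = M2 / 2 * (a - r)\<^sup>2"
  have "0 \<le> c" using \<open>0 \<le> M2\<close> by (simp add: c_def)
  have "\<bar>\<phi> t a - \<phi> t r - jacobian t r * (a - r)\<bar> \<le> c * t * exp (2 * M * t)"
  proof (rule ode_estimate[where y = "\<lambda>s. \<phi> s a - \<phi> s r - jacobian s r * (a - r)"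
        and p = "\<lambda>s. f1 (\<phi> s r) * (\<phi> s a - \<phi> s r - jacobian s r * (a - r))"
        and g = "\<lambda>s. f (\<phi> s a) - f (\<phi> s r) - f1 (\<phi> s r) * (\<phi> s a - \<phi> s r)"
        and H = "\<lambda>s. c * s * exp (2 * M * s)"
        and H' = "\<lambda>s. c * exp (2 * M * s) + 2 * M * (c * s * exp (2 * M * s))" and M = M])
    fix s :: real assume "0 \<le> s"
    show "((\<lambda>s. \<phi> s a - \<phi> s r - jacobian s r * (a - r)) has_real_derivative
        f1 (\<phi> s r) * (\<phi> s a - \<phi> s r - jacobian s r * (a - r)) +
        (f (\<phi> s a) - f (\<phi> s r) - f1 (\<phi> s r) * (\<phi> s a - \<phi> s r))) (at s within {0..})"
      using flow_solves[unfolded solves_def] jacobian_time_derivative \<open>0 \<le> s\<close>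
      by (auto intro!: derivative_eq_intros simp: algebra_simps)
    show "0 \<le> c * s * exp (2 * M * s)" using \<open>0 \<le> s\<close> \<open>0 \<le> c\<close> by simp
  next
    fix s :: real assume "0 < s"
    have bounds: "\<bar>\<phi> s a\<bar> \<le> K" "\<bar>\<phi> s r\<bar> \<le> K" using flow_abs_le assms \<open>0 < s\<close> by auto
    show "\<bar>f1 (\<phi> s r) * (\<phi> s a - \<phi> s r - jacobian s r * (a - r))\<bar> \<le> M * \<bar>\<phi> s a - \<phi> s r - jacobian s r * (a - r)\<bar>"
      unfolding abs_mult using M[OF bounds(2)] by (intro mult_right_mono) auto
    have "\<bar>\<phi> s a - \<phi> s r\<bar>\<^sup>2 \<le> (exp (M * s) * \<bar>a - r\<bar>)\<^sup>2"
      using flow_diff_le[OF assms(1-3) M, of s] \<open>0 < s\<close> by (intro power_mono) auto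
    also have "\<dots> = exp (2 * M * s) * (a - r)\<^sup>2"
      by (simp add: power_mult_distrib flip: exp_of_nat_mult)
    finally have sq: "(\<phi> s a - \<phi> s r)\<^sup>2 \<le> exp (2 * M * s) * (a - r)\<^sup>2" by simp
    have "\<bar>f (\<phi> s a) - f (\<phi> s r) - f1 (\<phi> s r) * (\<phi> s a - \<phi> s r)\<bar> \<le> M2 / 2 * (\<phi> s a - \<phi> s r)\<^sup>2"
      by (rule first_order_taylor_bound[OF f1 f2 M2 bounds(2,1)])
    also have "\<dots> \<le> M2 / 2 * (exp (2 * M * s) * (a - r)\<^sup>2)"
      using sq \<open>0 \<le> M2\<close> by (intro mult_left_mono) auto
    also have "\<dots> = c * exp (2 * M * s)" by (simp add: c_def)
    also have "\<dots> \<le> c * exp (2 * M * s) + M * (c * s * exp (2 * M * s))"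
      using \<open>0 \<le> M\<close> \<open>0 \<le> c\<close> \<open>0 < s\<close> by simp
    finally show "\<bar>f (\<phi> s a) - f (\<phi> s r) - f1 (\<phi> s r) * (\<phi> s a - \<phi> s r)\<bar>
        \<le> c * exp (2 * M * s) + 2 * M * (c * s * exp (2 * M * s)) - M * (c * s * exp (2 * M * s))"
      by simp
  next
    fix s :: real
    show "((\<lambda>s. c * s * exp (2 * M * s)) has_real_derivative
        c * exp (2 * M * s) + 2 * M * (c * s * exp (2 * M * s))) (at s)"
      by (auto intro!: derivative_eq_intros)
  qed (use \<open>0 \<le> t\<close> in \<open>auto simp: flow_0 jacobian_def\<close>)
  thus ?thesis by (simp add: c_def mult_ac)
qed

lemma flow_derivative:
  assumes "0 \<le> t"
  shows "(\<phi> t has_real_derivative jacobian t r) (at r)"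
proof -
  define K where "K = \<bar>r\<bar> + 1"
  obtain M where M: "0 \<le> M" "\<And>r. \<bar>r\<bar> \<le> K \<Longrightarrow> \<bar>f1 r\<bar> \<le> M"
    using bound_on_interval[OF continuous_f1] by blast
  obtain M2 where M2: "0 \<le> M2" "\<And>r. \<bar>r\<bar> \<le> K \<Longrightarrow> \<bar>f2 r\<bar> \<le> M2"
    using bound_on_interval[OF continuous_f2] by blast
  show ?thesis
    by (rule has_derivative_if_quadratic_remainder, rule flow_quadratic_remainder[where K = K])
      (use M M2 assms in \<open>auto simp: K_def\<close>)
qed

text \<open>
  The derivative in \<open>r\<close> of \<open>ln \<phi>\<^sub>r\<close>, whence \<open>\<phi>\<^sub>r\<^sub>r = jacobian * jacobian_log_deriv\<close>.
\<close>

definition jacobian_log_deriv :: "real \<Rightarrow> real \<Rightarrow> real" where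
  "jacobian_log_deriv t r = integral {0..t} (\<lambda>s. f2 (\<phi> s r) * jacobian s r)"

lemma jacobian_derivative:
  assumes "0 \<le> t"
  shows "(jacobian t has_real_derivative jacobian t r * jacobian_log_deriv t r) (at r)"
proof -
  define K where "K = \<bar>r\<bar> + 1"
  obtain M where M: "0 \<le> M" "\<And>r. \<bar>r\<bar> \<le> K \<Longrightarrow> \<bar>f1 r\<bar> \<le> M"
    using bound_on_interval[OF continuous_f1] by blast
  obtain M2 where M2: "0 \<le> M2" "\<And>r. \<bar>r\<bar> \<le> K \<Longrightarrow> \<bar>f2 r\<bar> \<le> M2"
    using bound_on_interval[OF continuous_f2] by blast
  obtain M3 where M3: "0 \<le> M3" "\<And>r. \<bar>r\<bar> \<le> K \<Longrightarrow> \<bar>f3 r\<bar> \<le> M3"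
    using bound_on_interval[OF continuous_f3] by blast
  define C where "C = M3 / 2 * (exp (M * t))\<^sup>2 + M2 * (M2 / 2 * t * exp (2 * M * t))"
  define I where "I r = integral {0..t} (\<lambda>s. f1 (\<phi> s r))" for r
  have "(I has_real_derivative jacobian_log_deriv t r) (at r)"
  proof (rule has_derivative_if_quadratic_remainder)
    fix a assume "\<bar>a - r\<bar> < 1"
    hence K: "\<bar>a\<bar> \<le> K" "\<bar>r\<bar> \<le> K" "1 \<le> K" by (auto simp: K_def)
    \<comment> \<open>The integrand splits into the Taylor remainder of \<open>f1\<close> and \<open>f2\<close> times the remainder of the flow.\<close>
    let ?h = "\<lambda>s. f1 (\<phi> s a) - f1 (\<phi> s r) - f2 (\<phi> s r) * jacobian s r * (a - r)"
    have "\<bar>?h s\<bar> \<le> C * (a - r)\<^sup>2" if "s \<in> {0..t}" for s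
    proof -
      have s: "0 \<le> s" "s \<le> t" using that by auto
      have bounds: "\<bar>\<phi> s a\<bar> \<le> K" "\<bar>\<phi> s r\<bar> \<le> K" using flow_abs_le K s by auto
      have "\<bar>\<phi> s a - \<phi> s r\<bar> \<le> exp (M * s) * \<bar>a - r\<bar>"
        using K M s by (intro flow_diff_le[where K = K]) auto
      also have "\<dots> \<le> exp (M * t) * \<bar>a - r\<bar>"
        using M(1) s by (intro mult_right_mono) (auto simp: mult_left_mono)
      finally have "\<bar>\<phi> s a - \<phi> s r\<bar> \<le> exp (M * t) * \<bar>a - r\<bar>" .
      hence "\<bar>\<phi> s a - \<phi> s r\<bar>\<^sup>2 \<le> (exp (M * t) * \<bar>a - r\<bar>)\<^sup>2"
        by (intro power_mono) auto
      hence sq: "(\<phi> s a - \<phi> s r)\<^sup>2 \<le> (exp (M * t))\<^sup>2 * (a - r)\<^sup>2"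
        by (simp add: power_mult_distrib)
      have "\<bar>f1 (\<phi> s a) - f1 (\<phi> s r) - f2 (\<phi> s r) * (\<phi> s a - \<phi> s r)\<bar> \<le> M3 / 2 * (\<phi> s a - \<phi> s r)\<^sup>2"
        by (rule first_order_taylor_bound[OF f2 f3 M3(2) bounds(2,1)])
      also have "\<dots> \<le> M3 / 2 * ((exp (M * t))\<^sup>2 * (a - r)\<^sup>2)"
        using sq M3(1) by (intro mult_left_mono) auto
      finally have 1: "\<bar>f1 (\<phi> s a) - f1 (\<phi> s r) - f2 (\<phi> s r) * (\<phi> s a - \<phi> s r)\<bar>
          \<le> M3 / 2 * ((exp (M * t))\<^sup>2 * (a - r)\<^sup>2)" .
      have "\<bar>\<phi> s a - \<phi> s r - jacobian s r * (a - r)\<bar> \<le> M2 / 2 * s * exp (2 * M * s) * (a - r)\<^sup>2"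
        by (rule flow_quadratic_remainder[OF K M(2) M2(2) s(1)])
      also have "\<dots> \<le> M2 / 2 * t * exp (2 * M * t) * (a - r)\<^sup>2"
        using M(1) M2(1) s by (intro mult_right_mono mult_mono) (auto simp: mult_left_mono)
      finally have "\<bar>f2 (\<phi> s r) * (\<phi> s a - \<phi> s r - jacobian s r * (a - r))\<bar>
          \<le> M2 * (M2 / 2 * t * exp (2 * M * t) * (a - r)\<^sup>2)"
        unfolding abs_mult using M2(2)[OF bounds(2)] M2(1) by (intro mult_mono) auto
      with 1 have "\<bar>f1 (\<phi> s a) - f1 (\<phi> s r) - f2 (\<phi> s r) * (\<phi> s a - \<phi> s r)\<bar>
          + \<bar>f2 (\<phi> s r) * (\<phi> s a - \<phi> s r - jacobian s r * (a - r))\<bar> \<le> C * (a - r)\<^sup>2"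
        by (simp add: C_def algebra_simps)
      moreover have "?h s = (f1 (\<phi> s a) - f1 (\<phi> s r) - f2 (\<phi> s r) * (\<phi> s a - \<phi> s r))
          + f2 (\<phi> s r) * (\<phi> s a - \<phi> s r - jacobian s r * (a - r))"
        by (simp add: algebra_simps)
      ultimately show ?thesis by linarith
    qed
    hence "norm (integral {0..t} ?h) \<le> C * (a - r)\<^sup>2 * (t - 0)"
      using assms by (intro integral_bound continuous_intros continuous_f1_flow continuous_f2_flow continuous_jacobian) auto
    moreover have "integral {0..t} ?h = I a - I r - jacobian_log_deriv t r * (a - r)"
      unfolding I_def jacobian_log_deriv_def
      by (simp add: integral_diff integrable_continuous_interval continuous_intros
          continuous_f1_flow continuous_f2_flow continuous_jacobian)
    ultimately show "\<bar>I a - I r - jacobian_log_deriv t r * (a - r)\<bar> \<le> C * t * (a - r)\<^sup>2"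
      by (simp add: mult_ac)
  qed
  thus ?thesis unfolding jacobian_def I_def
    by (auto intro!: derivative_eq_intros)
qed

lemma jacobian_derivative_abs_le:
  assumes K: "\<bar>r\<bar> \<le> K" "1 \<le> K" and M: "\<And>r. \<bar>r\<bar> \<le> K \<Longrightarrow> \<bar>f1 r\<bar> \<le> M"
    and M2: "\<And>r. \<bar>r\<bar> \<le> K \<Longrightarrow> \<bar>f2 r\<bar> \<le> M2" and "0 \<le> t"
  shows "\<bar>jacobian t r * jacobian_log_deriv t r\<bar> \<le> t * M2 * exp (2 * M * t)"
proof -
  have "0 \<le> M" "0 \<le> M2" using M[of 0] M2[of 0] \<open>1 \<le> K\<close> by auto
  have "norm (f2 (\<phi> s r) * jacobian s r) \<le> M2 * exp (M * t)" if "s \<in> {0..t}" for s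
  proof -
    have "jacobian s r \<le> exp (M * s)" using jacobian_le[OF K M] that by auto
    also have "\<dots> \<le> exp (M * t)" using that \<open>0 \<le> M\<close> by (simp add: mult_left_mono)
    finally show ?thesis
      using M2[OF flow_abs_le[OF K, of s]] that \<open>0 \<le> M2\<close> jacobian_pos[of s r]
      by (auto simp: abs_mult intro!: mult_mono)
  qed
  hence "norm (jacobian_log_deriv t r) \<le> M2 * exp (M * t) * (t - 0)"
    unfolding jacobian_log_deriv_def using \<open>0 \<le> t\<close>
    by (intro integral_bound continuous_intros continuous_f2_flow continuous_jacobian) auto
  hence "\<bar>jacobian t r * jacobian_log_deriv t r\<bar> \<le> exp (M * t) * (M2 * exp (M * t) * t)"
    unfolding abs_mult using jacobian_le[OF K M \<open>0 \<le> t\<close>] jacobian_pos[of t r]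
    by (intro mult_mono) auto
  also have "\<dots> = t * M2 * exp (2 * M * t)"
    by (simp flip: exp_add)
  finally show ?thesis .
qed

text \<open>
  The total derivative of \<open>s \<mapsto> \<phi>(s, v(s))\<close>. Expanding in the second argument around the fixed value \<open>v(t)\<close>
  replaces joint differentiability of \<open>\<phi>\<close> by the locally uniform remainder bound.
\<close>

lemma flow_along_curve_derivative:
  assumes "0 < t" and v: "(v has_real_derivative v') (at t)"
  shows "((\<lambda>s. \<phi> s (v s)) has_real_derivative f (\<phi> t (v t)) + jacobian t (v t) * v') (at t)"
proof -
  define K where "K = \<bar>v t\<bar> + 1"
  obtain M where M: "0 \<le> M" "\<And>r. \<bar>r\<bar> \<le> K \<Longrightarrow> \<bar>f1 r\<bar> \<le> M"
    using bound_on_interval[OF continuous_f1] by blast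
  obtain M2 where M2: "0 \<le> M2" "\<And>r. \<bar>r\<bar> \<le> K \<Longrightarrow> \<bar>f2 r\<bar> \<le> M2"
    using bound_on_interval[OF continuous_f2] by blast
  define C where "C = M2 / 2 * (t + 1) * exp (2 * M * (t + 1))"
  define R where "R s = \<phi> s (v s) - \<phi> s (v t) - jacobian s (v t) * (v s - v t)" for s
  have "(v \<longlongrightarrow> v t) (nhds t)"
    using DERIV_isCont[OF v] by (simp add: continuous_at tendsto_nhds_iff isCont_def)
  hence "\<forall>\<^sub>F s in nhds t. dist (v s) (v t) < 1"
    by (rule tendstoD) simp
  moreover have "\<forall>\<^sub>F s in nhds t. s \<in> {0<..<t+1}"
    using \<open>0 < t\<close> by (intro eventually_nhds_in_open) auto
  ultimately have "\<forall>\<^sub>F s in nhds t. \<bar>R s\<bar> \<le> C * (v s - v t)\<^sup>2"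
  proof eventually_elim
    case (elim s)
    have "\<bar>R s\<bar> \<le> M2 / 2 * s * exp (2 * M * s) * (v s - v t)\<^sup>2"
      unfolding R_def using elim M M2
      by (intro flow_quadratic_remainder[where K = K]) (auto simp: K_def dist_real_def)
    also have "\<dots> \<le> C * (v s - v t)\<^sup>2"
      unfolding C_def using elim M(1) M2(1) by (intro mult_right_mono mult_mono) (auto simp: mult_left_mono)
    finally show ?case .
  qed
  from derivative_zero_if_quadratic[OF v this]
  have "((\<lambda>s. R s + \<phi> s (v t) + jacobian s (v t) * (v s - v t)) has_real_derivative
     f (\<phi> t (v t)) + jacobian t (v t) * v') (at t)"
    using v solves_at[OF flow_solves \<open>0 < t\<close>] \<open>0 < t\<close>
      has_derivative_at_if_within_nonneg[OF jacobian_time_derivative, of t "v t"]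
    by (auto intro!: derivative_eq_intros)
  thus ?thesis by (simp add: R_def)
qed

lemma flow_jointly_continuous: "continuous_on ({0..} \<times> UNIV) (\<lambda>(t, r). \<phi> t r)"
  unfolding continuous_on_eq_continuous_within
proof
  fix p0 :: "real \<times> real" assume "p0 \<in> {0..} \<times> UNIV"
  then obtain t0 r0 where p0: "p0 = (t0, r0)" "0 \<le> t0" by auto
  let ?F = "at p0 within {0..} \<times> UNIV"
  define K where "K = \<bar>r0\<bar> + 1"
  obtain M where M: "0 \<le> M" "\<And>r. \<bar>r\<bar> \<le> K \<Longrightarrow> \<bar>f1 r\<bar> \<le> M"
    using bound_on_interval[OF continuous_f1] by blast
  have fst: "(fst \<longlongrightarrow> t0) ?F" and snd: "(snd \<longlongrightarrow> r0) ?F"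
    using tendsto_fst[OF tendsto_ident_at, of p0] tendsto_snd[OF tendsto_ident_at, of p0] by (auto simp: p0)
  have within: "\<forall>\<^sub>F p in ?F. p \<in> {0..} \<times> UNIV"
    by (simp add: eventually_at_filter)
  have bound: "\<forall>\<^sub>F p in ?F. norm (\<phi> (fst p) (snd p) - \<phi> (fst p) r0) \<le> exp (M * (t0 + 1)) * \<bar>snd p - r0\<bar>"
    using tendstoD[OF fst, of 1, OF zero_less_one] tendstoD[OF snd, of 1, OF zero_less_one] within
  proof eventually_elim
    case (elim p)
    have "\<bar>\<phi> (fst p) (snd p) - \<phi> (fst p) r0\<bar> \<le> exp (M * fst p) * \<bar>snd p - r0\<bar>"
      using elim M by (intro flow_diff_le[where K = K]) (auto simp: K_def dist_real_def)
    also have "\<dots> \<le> exp (M * (t0 + 1)) * \<bar>snd p - r0\<bar>"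
      using elim M(1) by (intro mult_right_mono) (auto simp: mult_left_mono dist_real_def)
    finally show ?case by simp
  qed
  have "((\<lambda>p. \<phi> (fst p) (snd p) - \<phi> (fst p) r0) \<longlongrightarrow> 0) ?F"
  proof (rule Lim_null_comparison[OF bound])
    have "((\<lambda>p. exp (M * (t0 + 1)) * \<bar>snd p - r0\<bar>) \<longlongrightarrow> exp (M * (t0 + 1)) * \<bar>r0 - r0\<bar>) ?F"
      by (intro tendsto_intros snd)
    thus "((\<lambda>p. exp (M * (t0 + 1)) * \<bar>snd p - r0\<bar>) \<longlongrightarrow> 0) ?F" by simp
  qed
  moreover have "((\<lambda>p. \<phi> (fst p) r0) \<longlongrightarrow> \<phi> t0 r0) ?F"
  proof -
    have "continuous_on ({0..} \<times> (UNIV :: real set)) (\<lambda>p. \<phi> (fst p) r0)"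
      by (rule continuous_on_compose2[OF flow_continuous continuous_on_fst[OF continuous_on_id]]) auto
    thus ?thesis using p0 by (auto simp: continuous_on_def)
  qed
  ultimately have "((\<lambda>p. \<phi> (fst p) (snd p)) \<longlongrightarrow> 0 + \<phi> t0 r0) ?F"
    using tendsto_add by fastforce
  thus "continuous ?F (\<lambda>(t, r). \<phi> t r)"
    by (simp add: continuous_within case_prod_unfold p0)
qed

end

section \<open>The heat semigroup\<close>

text \<open>
  Dominated convergence along sequences of difference quotients, which the mean value theorem bounds by \<open>g\<close>.
\<close>

lemma differentiate_under_integral:
  fixes F F' :: "real \<Rightarrow> 'a \<Rightarrow> real"
  assumes "0 < \<delta>"
    and int: "\<And>s. \<bar>s - s0\<bar> < \<delta> \<Longrightarrow> integrable M (F s)"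
    and F': "\<And>s y. \<bar>s - s0\<bar> < \<delta> \<Longrightarrow> ((\<lambda>s. F s y) has_real_derivative F' s y) (at s)"
    and dom: "\<And>s y. \<bar>s - s0\<bar> < \<delta> \<Longrightarrow> \<bar>F' s y\<bar> \<le> g y"
    and g: "integrable M g"
    and meas: "F' s0 \<in> borel_measurable M"
  shows "((\<lambda>s. \<integral>y. F s y \<partial>M) has_real_derivative (\<integral>y. F' s0 y \<partial>M)) (at s0)"
proof -
  have ball: "s \<in> ball s0 \<delta> \<longleftrightarrow> \<bar>s - s0\<bar> < \<delta>" for s
    by (auto simp: dist_real_def abs_minus_commute)
  have "((\<lambda>s. ((\<integral>y. F s y \<partial>M) - (\<integral>y. F s0 y \<partial>M)) / (s - s0)) \<longlongrightarrow> (\<integral>y. F' s0 y \<partial>M)) (at s0 within ball s0 \<delta>)"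
    unfolding tendsto_at_iff_sequentially
  proof (intro allI impI)
    fix X :: "nat \<Rightarrow> real"
    assume X: "\<forall>i. X i \<in> ball s0 \<delta> - {s0}" and lim: "X \<longlonglongrightarrow> s0"
    have near: "\<bar>X i - s0\<bar> < \<delta>" "X i \<noteq> s0" for i
      using X ball by auto
    have "(\<lambda>i. \<integral>y. (F (X i) y - F s0 y) / (X i - s0) \<partial>M) \<longlonglongrightarrow> (\<integral>y. F' s0 y \<partial>M)"
    proof (rule integral_dominated_convergence[OF meas _ g])
      show "(\<lambda>y. (F (X i) y - F s0 y) / (X i - s0)) \<in> borel_measurable M" for i
        using int[OF near(1)[of i]] int[of s0] \<open>0 < \<delta>\<close> by auto
      show "AE y in M. (\<lambda>i. (F (X i) y - F s0 y) / (X i - s0)) \<longlonglongrightarrow> F' s0 y"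
      proof (rule AE_I2)
        fix y
        have "((\<lambda>s. (F s y - F s0 y) / (s - s0)) \<longlongrightarrow> F' s0 y) (at s0)"
          using F'[of s0 y] \<open>0 < \<delta>\<close> by (simp add: has_field_derivative_iff)
        thus "(\<lambda>i. (F (X i) y - F s0 y) / (X i - s0)) \<longlonglongrightarrow> F' s0 y"
          using near(2) lim unfolding tendsto_at_iff_sequentially comp_def by auto
      qed
      show "AE y in M. norm ((F (X i) y - F s0 y) / (X i - s0)) \<le> g y" for i
      proof (rule AE_I2)
        fix y
        have "norm (F (X i) y - F s0 y) \<le> g y * norm (X i - s0)"
        proof (rule field_differentiable_bound[of "ball s0 \<delta>"])
          show "((\<lambda>s. F s y) has_field_derivative F' s y) (at s within ball s0 \<delta>)" if "s \<in> ball s0 \<delta>" for s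
            using F' that ball by (simp add: has_field_derivative_at_within)
          show "norm (F' s y) \<le> g y" if "s \<in> ball s0 \<delta>" for s
            using dom that ball by simp
        qed (use ball near \<open>0 < \<delta>\<close> in auto)
        thus "norm ((F (X i) y - F s0 y) / (X i - s0)) \<le> g y"
          using near(2)[of i] by (simp add: field_simps)
      qed
    qed
    moreover have "(\<integral>y. (F (X i) y - F s0 y) / (X i - s0) \<partial>M)
        = ((\<integral>y. F (X i) y \<partial>M) - (\<integral>y. F s0 y \<partial>M)) / (X i - s0)" for i
      using int[OF near(1)[of i]] int[of s0] \<open>0 < \<delta>\<close>
      by (simp add: Bochner_Integration.integral_diff)
    ultimately show "((\<lambda>s. ((\<integral>y. F s y \<partial>M) - (\<integral>y. F s0 y \<partial>M)) / (s - s0)) \<circ> X) \<longlonglongrightarrow> (\<integral>y. F' s0 y \<partial>M)"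
      by (simp only: comp_def)
  qed
  moreover have "at s0 within ball s0 \<delta> = at s0"
    using \<open>0 < \<delta>\<close> by (intro at_within_open) auto
  ultimately show ?thesis by (simp only: has_field_derivative_iff)
qed

lemma heat_kernel_eq_normal_density:
  assumes "0 < t" shows "heat_kernel t (x - y) = normal_density x (sqrt (2 * t)) y"
  using assms by (simp add: heat_kernel_def normal_density_def power2_commute)

lemma heat_kernel_nonneg: "0 < t \<Longrightarrow> 0 \<le> heat_kernel t z"
  by (simp add: heat_kernel_def)

lemma measurable_heat_kernel [measurable]: "heat_kernel t \<in> borel_measurable borel"
  unfolding heat_kernel_def[abs_def] by measurable

lemma integral_heat_kernel_abs:
  assumes "0 < t" shows "(\<integral>y. heat_kernel t (x - y) * \<bar>x - y\<bar> \<partial>lborel) = 2 * sqrt (t / pi)"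
proof -
  have "(\<integral>y. heat_kernel t (x - y) * \<bar>x - y\<bar> \<partial>lborel) = sqrt (2 * t) * sqrt (2 / pi)"
    using integral_normal_moment_abs_odd[of "sqrt (2 * t)" x 0] assms
    by (simp add: heat_kernel_eq_normal_density abs_minus_commute)
  also have "\<dots> = 2 * sqrt (t / pi)"
    by (simp add: real_sqrt_mult real_sqrt_divide)
  finally show ?thesis .
qed

lemma measurable_poly [measurable]: "poly p \<in> borel_measurable borel" for p :: "real poly"
  by (intro borel_measurable_continuous_onI continuous_intros)

lemma integrable_poly_heat_kernel:
  assumes "0 < t"
  shows "integrable lborel (\<lambda>y. poly p (x - y) * heat_kernel t (x - y))"
proof -
  have "integrable lborel (\<lambda>y. \<Sum>i\<le>degree p. coeff p i * (-1) ^ i * (normal_density x (sqrt (2 * t)) y * (y - x) ^ i))"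
    using assms by (intro Bochner_Integration.integrable_sum integrable_mult_right integrable_normal_moment) auto
  moreover have "(x - y) ^ i = (-1) ^ i * (y - x) ^ i" for y i
    by (metis minus_diff_eq mult_minus1 power_mult_distrib)
  ultimately show ?thesis
    using assms by (simp add: poly_altdef heat_kernel_eq_normal_density sum_distrib_right sum_distrib_left mult_ac)
qed

lemma integrable_poly_heat_kernel_mult:
  assumes "0 < t" and [measurable]: "b \<in> borel_measurable borel" and B: "\<And>y. \<bar>b y\<bar> \<le> B"
  shows "integrable lborel (\<lambda>y. poly p (x - y) * heat_kernel t (x - y) * b y)"
proof (rule Bochner_Integration.integrable_bound)
  show "integrable lborel (\<lambda>y. B * (poly p (x - y) * heat_kernel t (x - y)))"
    by (intro integrable_mult_right integrable_poly_heat_kernel \<open>0 < t\<close>)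
  show "AE y in lborel. norm (poly p (x - y) * heat_kernel t (x - y) * b y)
      \<le> norm (B * (poly p (x - y) * heat_kernel t (x - y)))"
  proof (rule AE_I2)
    fix y
    have "\<bar>b y\<bar> \<le> \<bar>B\<bar>" using B[of y] by simp
    thus "norm (poly p (x - y) * heat_kernel t (x - y) * b y) \<le> norm (B * (poly p (x - y) * heat_kernel t (x - y)))"
      by (simp add: abs_mult mult_right_mono mult_ac)
  qed
qed measurable

lemma integrable_heat_kernel_mult:
  assumes "0 < t" "b \<in> borel_measurable borel" "\<And>y. \<bar>b y\<bar> \<le> B"
  shows "integrable lborel (\<lambda>y. heat_kernel t (x - y) * b y)"
  using integrable_poly_heat_kernel_mult[OF assms, of 1] by simp

text \<open>
  Space derivatives of a polynomial times the heat kernel are again of that form; this operator acts on the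
  polynomial factor.
\<close>

definition gauss_pderiv :: "real \<Rightarrow> real poly \<Rightarrow> real poly" where
  "gauss_pderiv t p = pderiv p - smult (1 / (2 * t)) (pCons 0 p)"

lemma poly_heat_kernel_derivative:
  assumes "0 < t"
  shows "((\<lambda>z. poly p z * heat_kernel t z) has_real_derivative poly (gauss_pderiv t p) z * heat_kernel t z) (at z)"
proof -
  have "(heat_kernel t has_real_derivative - z / (2 * t) * heat_kernel t z) (at z)"
    unfolding heat_kernel_def using assms
    by (auto intro!: derivative_eq_intros simp: field_simps)
  from DERIV_mult[OF poly_DERIV[of p z] this] show ?thesis
    by (simp add: gauss_pderiv_def algebra_simps)
qed

text \<open>
  An even polynomial that dominates all translates of \<open>p\<close> by less than 1, by
  \<open>\<bar>z + d\<bar> \<le> 2 + z\<^sup>2\<close>.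
\<close>

definition poly_majorant :: "real poly \<Rightarrow> real poly" where
  "poly_majorant p = (\<Sum>i\<le>degree p. smult \<bar>coeff p i\<bar> ([:2, 0, 1:] ^ i))"

lemma poly_majorant:
  assumes "\<bar>d\<bar> < 1"
  shows "\<bar>poly p (z + d)\<bar> \<le> poly (poly_majorant p) z"
proof -
  have "\<bar>z\<bar> \<le> 1 + z\<^sup>2"
    using sum_squares_bound[of "\<bar>z\<bar>" 1] by (simp add: power2_eq_square)
  hence "\<bar>z + d\<bar> \<le> 2 + z\<^sup>2" using assms by linarith
  hence "\<bar>z + d\<bar> ^ i \<le> (2 + z\<^sup>2) ^ i" for i
    by (intro power_mono) auto
  hence "(\<Sum>i\<le>degree p. \<bar>coeff p i\<bar> * \<bar>z + d\<bar> ^ i) \<le> (\<Sum>i\<le>degree p. \<bar>coeff p i\<bar> * (2 + z\<^sup>2) ^ i)"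
    by (intro sum_mono mult_left_mono) auto
  moreover have "\<bar>poly p (z + d)\<bar> \<le> (\<Sum>i\<le>degree p. \<bar>coeff p i\<bar> * \<bar>z + d\<bar> ^ i)"
    unfolding poly_altdef by (rule order_trans[OF sum_abs]) (simp add: abs_mult power_abs)
  ultimately show ?thesis
    by (simp add: poly_majorant_def poly_sum poly_power power2_eq_square)
qed

text \<open>
  Doubling the time absorbs a bounded translation: \<open>(z + d)\<^sup>2 \<ge> z\<^sup>2 / 2 - d\<^sup>2\<close>. Together with
  \<open>poly_majorant\<close> this gives an integrable majorant that is locally uniform in space.
\<close>

lemma heat_kernel_shift_le:
  assumes "0 < t" "\<bar>d\<bar> < 1"
  shows "heat_kernel t (z + d) \<le> sqrt 2 * exp (1 / (4 * t)) * heat_kernel (2 * t) z"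
proof -
  have "d\<^sup>2 \<le> 1" using assms(2) by (simp add: abs_square_le_1)
  moreover have "0 \<le> (z + 2 * d)\<^sup>2" by simp
  ultimately have "z\<^sup>2 / 2 - 1 \<le> (z + d)\<^sup>2"
    by (simp add: power2_eq_square algebra_simps)
  hence "(z\<^sup>2 / 2 - 1) / (4 * t) \<le> (z + d)\<^sup>2 / (4 * t)"
    using assms by (intro divide_right_mono) auto
  hence "- (z + d)\<^sup>2 / (4 * t) \<le> 1 / (4 * t) + - z\<^sup>2 / (4 * (2 * t))"
    by (simp add: diff_divide_distrib)
  hence "exp (- (z + d)\<^sup>2 / (4 * t)) \<le> exp (1 / (4 * t)) * exp (- z\<^sup>2 / (4 * (2 * t)))"
    by (simp flip: exp_add)
  hence "exp (- (z + d)\<^sup>2 / (4 * t)) / sqrt (4 * pi * t)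
      \<le> exp (1 / (4 * t)) * exp (- z\<^sup>2 / (4 * (2 * t))) / sqrt (4 * pi * t)"
    using assms by (intro divide_right_mono) auto
  moreover have "sqrt (4 * pi * (2 * t)) = sqrt 2 * sqrt (4 * pi * t)"
    by (simp flip: real_sqrt_mult)
  ultimately show ?thesis
    by (simp add: heat_kernel_def)
qed

lemma poly_heat_kernel_convolution_derivative:
  assumes "0 < t" and [measurable]: "b \<in> borel_measurable borel" and B: "\<And>y. \<bar>b y\<bar> \<le> B"
  shows "((\<lambda>x. \<integral>y. poly p (x - y) * heat_kernel t (x - y) * b y \<partial>lborel) has_real_derivative
      (\<integral>y. poly (gauss_pderiv t p) (x - y) * heat_kernel t (x - y) * b y \<partial>lborel)) (at x)"
proof (rule differentiate_under_integral[where \<delta> = 1])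
  let ?q = "gauss_pderiv t p"
  define C where "C = sqrt 2 * exp (1 / (4 * t))"
  have "0 \<le> C" by (simp add: C_def)
  have "0 \<le> B" using B[of 0] by linarith
  show "integrable lborel (\<lambda>y. B * C * (poly (poly_majorant ?q) (x - y) * heat_kernel (2 * t) (x - y)))"
    using \<open>0 < t\<close> by (intro integrable_mult_right integrable_poly_heat_kernel) simp
  fix x' y :: real assume near: "\<bar>x' - x\<bar> < 1"
  show "((\<lambda>x. poly p (x - y) * heat_kernel t (x - y) * b y) has_real_derivative
      poly ?q (x' - y) * heat_kernel t (x' - y) * b y) (at x')"
    using DERIV_cmult_right[OF DERIV_shift[THEN iffD1, of "\<lambda>z. poly p z * heat_kernel t z" _ x' "-y"], of _ "b y"]
      poly_heat_kernel_derivative[OF \<open>0 < t\<close>, of p "x' - y"]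
    by simp
  have "\<bar>poly ?q (x' - y)\<bar> \<le> poly (poly_majorant ?q) (x - y)"
    using poly_majorant[OF near, of ?q "x - y"] by simp
  moreover have "heat_kernel t (x' - y) \<le> C * heat_kernel (2 * t) (x - y)"
    using heat_kernel_shift_le[OF \<open>0 < t\<close> near, of "x - y"] by (simp add: C_def)
  ultimately have "\<bar>poly ?q (x' - y)\<bar> * heat_kernel t (x' - y) * \<bar>b y\<bar>
      \<le> poly (poly_majorant ?q) (x - y) * (C * heat_kernel (2 * t) (x - y)) * B"
    using B[of y] \<open>0 \<le> B\<close> \<open>0 \<le> C\<close> \<open>0 < t\<close> heat_kernel_nonneg[of t] heat_kernel_nonneg[of "2 * t"]
    by (intro mult_mono) (auto intro: order_trans[OF abs_ge_zero])
  thus "\<bar>poly ?q (x' - y) * heat_kernel t (x' - y) * b y\<bar>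
      \<le> B * C * (poly (poly_majorant ?q) (x - y) * heat_kernel (2 * t) (x - y))"
    using heat_kernel_nonneg[OF \<open>0 < t\<close>, of "x' - y"] by (simp add: abs_mult mult_ac)
qed (auto intro: integrable_poly_heat_kernel_mult assms)

lemma heat_semigroup_iterated_deriv:
  assumes "0 < t" "b \<in> borel_measurable borel" "\<And>y. \<bar>b y\<bar> \<le> B"
  shows "(deriv ^^ n) (heat_semigroup t b)
    = (\<lambda>x. \<integral>y. poly ((gauss_pderiv t ^^ n) 1) (x - y) * heat_kernel t (x - y) * b y \<partial>lborel)"
proof (induction n)
  case 0
  show ?case using \<open>0 < t\<close> by (simp add: heat_semigroup_def)
next
  case (Suc n)
  show ?case
    using DERIV_imp_deriv[OF poly_heat_kernel_convolution_derivative[OF assms]]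
    by (auto simp: Suc)
qed

lemma heat_semigroup_smooth:
  assumes "0 < t" "b \<in> borel_measurable borel" "\<And>y. \<bar>b y\<bar> \<le> B"
  shows "smooth (heat_semigroup t b)"
  unfolding smooth_def heat_semigroup_iterated_deriv[OF assms]
  using poly_heat_kernel_convolution_derivative[OF assms] real_differentiable_def by blast

lemma heat_kernel_time_derivative:
  assumes "0 < s"
  shows "((\<lambda>s. heat_kernel s z) has_real_derivative (z\<^sup>2 / (4 * s\<^sup>2) - 1 / (2 * s)) * heat_kernel s z) (at s)"
proof -
  have "((\<lambda>s. exp (- z\<^sup>2 / (4 * s)) / sqrt (4 * pi * s)) has_real_derivative
      (exp (- z\<^sup>2 / (4 * s)) * (z\<^sup>2 / (4 * s\<^sup>2)) * sqrt (4 * pi * s)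
        - exp (- z\<^sup>2 / (4 * s)) * (4 * pi * (inverse (sqrt (4 * pi * s)) / 2)))
      / (sqrt (4 * pi * s) * sqrt (4 * pi * s))) (at s)"
    using assms by (auto intro!: derivative_eq_intros simp: power2_eq_square mult_less_0_iff)
  moreover have "(exp (- z\<^sup>2 / (4 * s)) * (z\<^sup>2 / (4 * s\<^sup>2)) * sqrt (4 * pi * s)
        - exp (- z\<^sup>2 / (4 * s)) * (4 * pi * (inverse (sqrt (4 * pi * s)) / 2)))
      / (sqrt (4 * pi * s) * sqrt (4 * pi * s)) = (z\<^sup>2 / (4 * s\<^sup>2) - 1 / (2 * s)) * (exp (- z\<^sup>2 / (4 * s)) / sqrt (4 * pi * s))"
  proof -
    have "(E * Z * q - E * (c * (inverse q / 2))) / (q * q) = (Z - 1 / (2 * s)) * (E / q)"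
      if "q > 0" "c = q * q / s" for E Z q c :: real
      using that assms by (simp add: field_simps)
    moreover have "sqrt (4 * pi * s) > 0" "4 * pi = sqrt (4 * pi * s) * sqrt (4 * pi * s) / s"
      using assms by auto
    ultimately show ?thesis by blast
  qed
  ultimately show ?thesis by (simp add: heat_kernel_def)
qed

lemma heat_kernel_time_le:
  assumes "0 < t" "\<bar>s - t\<bar> < t / 2"
  shows "heat_kernel s z \<le> 2 * heat_kernel (2 * t) z"
proof -
  have s: "t / 2 \<le> s" "s \<le> 2 * t" "0 < s" using assms by linarith+
  have "z\<^sup>2 / (4 * (2 * t)) \<le> z\<^sup>2 / (4 * s)"
    using s by (intro divide_left_mono) auto
  moreover have "sqrt (4 * pi * (2 * t)) \<le> 2 * sqrt (4 * pi * s)"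
    using s by (intro real_le_lsqrt) (auto simp: power_mult_distrib)
  ultimately have "exp (- z\<^sup>2 / (4 * s)) * sqrt (4 * pi * (2 * t)) \<le> exp (- z\<^sup>2 / (4 * (2 * t))) * (2 * sqrt (4 * pi * s))"
    using s by (intro mult_mono) auto
  thus ?thesis using s \<open>0 < t\<close> by (simp add: heat_kernel_def field_simps)
qed

text \<open>
  The datum \<open>b\<close> may depend on time, as in \<open>X\<^sup>t Y\<^sup>t u\<^sub>0\<close>. The first integral is the second space derivative,
  because the polynomial \<open>z\<^sup>2 / (4 t\<^sup>2) - 1 / (2 t)\<close> from the time derivative of the kernel is also the one that
  two space derivatives produce.
\<close>

lemma heat_semigroup_time_derivative:
  assumes "0 < t"
    and meas: "\<And>s. 0 < s \<Longrightarrow> b s \<in> borel_measurable borel" "\<And>s. 0 < s \<Longrightarrow> bt s \<in> borel_measurable borel"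
    and B: "\<And>s y. 0 < s \<Longrightarrow> \<bar>b s y\<bar> \<le> B" and B': "\<And>s y. 0 < s \<Longrightarrow> \<bar>bt s y\<bar> \<le> B'"
    and bt: "\<And>s y. 0 < s \<Longrightarrow> ((\<lambda>s. b s y) has_real_derivative bt s y) (at s)"
  shows "((\<lambda>s. heat_semigroup s (b s) x) has_real_derivative
     (\<integral>y. poly (gauss_pderiv t (gauss_pderiv t 1)) (x - y) * heat_kernel t (x - y) * b t y \<partial>lborel)
     + heat_semigroup t (bt t) x) (at t)"
proof -
  note [measurable] = meas(1)[OF \<open>0 < t\<close>] meas(2)[OF \<open>0 < t\<close>]
  define q where "q s = [: - 1 / (2 * s), 0, 1 / (4 * s\<^sup>2) :]" for s :: real
  have q: "poly (q s) z = z\<^sup>2 / (4 * s\<^sup>2) - 1 / (2 * s)" for s z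
    by (simp add: q_def power2_eq_square)
  have gauss: "gauss_pderiv t (gauss_pderiv t 1) = q t"
    by (simp add: gauss_pderiv_def q_def pderiv_pCons one_pCons power2_eq_square)
  have B0: "0 \<le> B" "0 \<le> B'" using B[of 1 0] B'[of 1 0] by auto
  have "((\<lambda>s. \<integral>y. heat_kernel s (x - y) * b s y \<partial>lborel) has_real_derivative
      (\<integral>y. poly (q t) (x - y) * heat_kernel t (x - y) * b t y + heat_kernel t (x - y) * bt t y \<partial>lborel)) (at t)"
  proof (rule differentiate_under_integral[where \<delta> = "t / 2"])
    \<comment> \<open>For \<open>s\<close> between \<open>t / 2\<close> and \<open>2 * t\<close> the kernel at time \<open>s\<close> is at most twice the kernel at time \<open>2 * t\<close>.\<close>
    show "integrable lborel (\<lambda>y. poly [:B / t + B', 0, B / t\<^sup>2:] (x - y) * heat_kernel (2 * t) (x - y) * 2)"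
      using \<open>0 < t\<close> by (intro integrable_mult_left integrable_poly_heat_kernel) simp
    fix s y :: real assume near: "\<bar>s - t\<bar> < t / 2"
    hence s: "0 < s" "t / 2 \<le> s" using \<open>0 < t\<close> by linarith+
    show "integrable lborel (\<lambda>y. heat_kernel s (x - y) * b s y)"
      using s(1) B meas(1) by (intro integrable_heat_kernel_mult) auto
    show "((\<lambda>s. heat_kernel s (x - y) * b s y) has_real_derivative
        poly (q s) (x - y) * heat_kernel s (x - y) * b s y + heat_kernel s (x - y) * bt s y) (at s)"
      using DERIV_mult[OF heat_kernel_time_derivative[OF s(1), of "x - y"] bt[OF s(1), of y]]
      by (simp add: q algebra_simps)
    have ts: "t\<^sup>2 \<le> 4 * s\<^sup>2" using power_mono[of t "2 * s" 2] s \<open>0 < t\<close> by (simp add: power_mult_distrib)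
    have "\<bar>poly (q s) (x - y)\<bar> \<le> (x - y)\<^sup>2 / (4 * s\<^sup>2) + 1 / (2 * s)"
      unfolding q using s by (intro abs_triangle_ineq4[THEN order_trans]) auto
    also have "\<dots> \<le> (x - y)\<^sup>2 / t\<^sup>2 + 1 / t"
      using ts s \<open>0 < t\<close> by (intro add_mono divide_left_mono) auto
    finally have 1: "\<bar>poly (q s) (x - y)\<bar> * \<bar>b s y\<bar> \<le> ((x - y)\<^sup>2 / t\<^sup>2 + 1 / t) * B"
      using B[OF s(1)] \<open>0 < t\<close> by (intro mult_mono) auto
    have "\<bar>poly (q s) (x - y) * heat_kernel s (x - y) * b s y + heat_kernel s (x - y) * bt s y\<bar>
        = heat_kernel s (x - y) * \<bar>poly (q s) (x - y) * b s y + bt s y\<bar>"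
      using heat_kernel_nonneg[OF s(1), of "x - y"]
      by (simp add: abs_mult_pos' algebra_simps)
    also have "\<dots> \<le> (2 * heat_kernel (2 * t) (x - y)) * (((x - y)\<^sup>2 / t\<^sup>2 + 1 / t) * B + B')"
    proof (intro mult_mono heat_kernel_time_le[OF \<open>0 < t\<close> near])
      show "\<bar>poly (q s) (x - y) * b s y + bt s y\<bar> \<le> ((x - y)\<^sup>2 / t\<^sup>2 + 1 / t) * B + B'"
        using 1 B'[OF s(1), of y] abs_triangle_ineq[of "poly (q s) (x - y) * b s y" "bt s y"]
        by (simp add: abs_mult)
    qed (use heat_kernel_nonneg[of "2 * t"] \<open>0 < t\<close> in auto)
    finally show "\<bar>poly (q s) (x - y) * heat_kernel s (x - y) * b s y + heat_kernel s (x - y) * bt s y\<bar>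
        \<le> poly [:B / t + B', 0, B / t\<^sup>2:] (x - y) * heat_kernel (2 * t) (x - y) * 2"
      by (simp add: algebra_simps power2_eq_square)
  qed (use \<open>0 < t\<close> in auto)
  also have "(\<integral>y. poly (q t) (x - y) * heat_kernel t (x - y) * b t y + heat_kernel t (x - y) * bt t y \<partial>lborel)
      = (\<integral>y. poly (q t) (x - y) * heat_kernel t (x - y) * b t y \<partial>lborel) + heat_semigroup t (bt t) x"
    using \<open>0 < t\<close> B[OF \<open>0 < t\<close>] B'[OF \<open>0 < t\<close>]
    by (subst Bochner_Integration.integral_add)
      (auto simp: heat_semigroup_def intro!: integrable_heat_kernel_mult integrable_poly_heat_kernel_mult)
  finally have der: "((\<lambda>s. \<integral>y. heat_kernel s (x - y) * b s y \<partial>lborel) has_real_derivative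
     (\<integral>y. poly (q t) (x - y) * heat_kernel t (x - y) * b t y \<partial>lborel) + heat_semigroup t (bt t) x) (at t)" .
  have ev: "\<forall>\<^sub>F s in nhds t. (\<integral>y. heat_kernel s (x - y) * b s y \<partial>lborel) = heat_semigroup s (b s) x"
    by (rule eventually_mono[OF eventually_nhds_in_open[of "{0<..}"]])
      (use \<open>0 < t\<close> in \<open>auto simp: heat_semigroup_def\<close>)
  show ?thesis
    unfolding gauss by (rule DERIV_cong_ev[OF refl ev refl, THEN iffD1, OF der])
qed

text \<open>
  Rescaling to the standard normal density makes the formula uniform in \<open>t\<close>, including \<open>t = 0\<close>. It yields the
  bounds, the continuity up to the initial time and the preservation of Lipschitz constants.
\<close>

lemma heat_semigroup_normal:
  assumes "0 \<le> t"
  shows "heat_semigroup t b x = (\<integral>\<eta>. std_normal_density \<eta> * b (x + sqrt (2 * t) * \<eta>) \<partial>lborel)"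
proof (cases "t = 0")
  case True
  thus ?thesis by (simp add: heat_semigroup_def)
next
  case False
  define c where "c = sqrt (2 * t)"
  have "0 < c" using False assms by (simp add: c_def)
  have "c * normal_density x c (x + c * \<eta>) = std_normal_density \<eta>" for \<eta>
    using \<open>0 < c\<close> by (simp add: normal_density_def real_sqrt_mult power_mult_distrib)
  moreover have "heat_semigroup t b x = c * (\<integral>\<eta>. normal_density x c (x + c * \<eta>) * b (x + c * \<eta>) \<partial>lborel)"
    using lborel_integral_real_affine[of c "\<lambda>y. normal_density x c y * b y" x] \<open>0 < c\<close> False assms
    by (simp add: heat_semigroup_def heat_kernel_eq_normal_density c_def)
  ultimately show ?thesis
    by (simp add: c_def mult.assoc[symmetric] flip: integral_mult_right_zero)
qed

lemma integrable_std_normal_mult: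
  assumes [measurable]: "h \<in> borel_measurable borel" and B: "\<And>\<eta>. \<bar>h \<eta>\<bar> \<le> B"
  shows "integrable lborel (\<lambda>\<eta>. std_normal_density \<eta> * h \<eta>)"
proof (rule Bochner_Integration.integrable_bound)
  show "integrable lborel (\<lambda>\<eta>. std_normal_density \<eta> * B)"
    by (intro integrable_mult_left) simp
  show "AE \<eta> in lborel. norm (std_normal_density \<eta> * h \<eta>) \<le> norm (std_normal_density \<eta> * B)"
    using order_trans[OF B abs_ge_self] by (intro AE_I2) (auto simp: abs_mult intro!: mult_left_mono)
qed measurable

lemma heat_semigroup_abs_le:
  assumes "0 \<le> t" and [measurable]: "b \<in> borel_measurable borel" and B: "\<And>y. \<bar>b y\<bar> \<le> B"
  shows "\<bar>heat_semigroup t b x\<bar> \<le> B"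
proof -
  have "norm (\<integral>\<eta>. std_normal_density \<eta> * b (x + sqrt (2 * t) * \<eta>) \<partial>lborel) \<le> (\<integral>\<eta>. std_normal_density \<eta> * B \<partial>lborel)"
    using B by (intro Bochner_Integration.integral_norm_bound_integral integrable_std_normal_mult)
      (auto simp: abs_mult intro!: mult_left_mono)
  thus ?thesis by (simp add: heat_semigroup_normal[OF assms(1)])
qed

lemma heat_semigroup_jointly_continuous:
  assumes cont: "continuous_on ({0..} \<times> UNIV) (\<lambda>(t, y). b t y)"
    and B: "\<And>t y. 0 \<le> t \<Longrightarrow> \<bar>b t y\<bar> \<le> B"
  shows "continuous_on ({0..} \<times> UNIV) (\<lambda>(t, x). heat_semigroup t (b t) x)"
  unfolding continuous_on_sequentially
proof (intro allI ballI impI)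
  fix X :: "nat \<Rightarrow> real \<times> real" and p
  assume p: "p \<in> {0..} \<times> UNIV" and X: "(\<forall>n. X n \<in> {0..} \<times> UNIV) \<and> X \<longlonglongrightarrow> p"
  define point where "point q \<eta> = (fst q, snd q + sqrt (2 * fst q) * \<eta>)" for q :: "real \<times> real" and \<eta> :: real
  have point_in: "point q \<eta> \<in> {0..} \<times> UNIV" if "q \<in> {0..} \<times> UNIV" for q \<eta>
    using that by (auto simp: point_def)
  have meas: "(\<lambda>\<eta>. (\<lambda>(t, y). b t y) (point q \<eta>)) \<in> borel_measurable borel" if "q \<in> {0..} \<times> UNIV" for q
    using point_in[OF that] unfolding point_def
    by (intro borel_measurable_continuous_onI continuous_on_compose2[OF cont] continuous_intros) auto
  have heat: "heat_semigroup (fst q) (b (fst q)) (snd q) = (\<integral>\<eta>. std_normal_density \<eta> * (\<lambda>(t, y). b t y) (point q \<eta>) \<partial>lborel)"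
    if "q \<in> {0..} \<times> UNIV" for q
    using that by (auto simp: heat_semigroup_normal point_def)
  have "(\<lambda>n. \<integral>\<eta>. std_normal_density \<eta> * (\<lambda>(t, y). b t y) (point (X n) \<eta>) \<partial>lborel)
      \<longlonglongrightarrow> (\<integral>\<eta>. std_normal_density \<eta> * (\<lambda>(t, y). b t y) (point p \<eta>) \<partial>lborel)"
  proof (rule integral_dominated_convergence[where w = "\<lambda>\<eta>. std_normal_density \<eta> * B"])
    have [measurable]: "(\<lambda>\<eta>. (\<lambda>(t, y). b t y) (point (X n) \<eta>)) \<in> borel_measurable borel"
      "(\<lambda>\<eta>. (\<lambda>(t, y). b t y) (point p \<eta>)) \<in> borel_measurable borel" for n
      using meas p X by blast+
    show "(\<lambda>\<eta>. std_normal_density \<eta> * (\<lambda>(t, y). b t y) (point (X n) \<eta>)) \<in> borel_measurable lborel"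
      "(\<lambda>\<eta>. std_normal_density \<eta> * (\<lambda>(t, y). b t y) (point p \<eta>)) \<in> borel_measurable lborel" for n
      by measurable
    show "AE \<eta> in lborel. (\<lambda>n. std_normal_density \<eta> * (\<lambda>(t, y). b t y) (point (X n) \<eta>))
        \<longlonglongrightarrow> std_normal_density \<eta> * (\<lambda>(t, y). b t y) (point p \<eta>)"
    proof (intro AE_I2 tendsto_intros)
      fix \<eta>
      have "(\<lambda>n. point (X n) \<eta>) \<longlonglongrightarrow> point p \<eta>"
        unfolding point_def using X by (intro tendsto_intros) auto
      thus "(\<lambda>n. (\<lambda>(t, y). b t y) (point (X n) \<eta>)) \<longlonglongrightarrow> (\<lambda>(t, y). b t y) (point p \<eta>)"
        using cont[unfolded continuous_on_sequentially, rule_format, OF point_in[OF p], of "\<lambda>n. point (X n) \<eta>" \<eta>] point_in X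
        by (simp add: comp_def)
    qed
    show "AE \<eta> in lborel. norm (std_normal_density \<eta> * (\<lambda>(t, y). b t y) (point (X n) \<eta>)) \<le> std_normal_density \<eta> * B" for n
      using B X by (intro AE_I2) (auto simp: abs_mult point_def case_prod_unfold mem_Times_iff intro!: mult_left_mono)
    show "integrable lborel (\<lambda>\<eta>. std_normal_density \<eta> * B)"
      by (intro integrable_mult_left) simp
  qed
  thus "((\<lambda>(t, x). heat_semigroup t (b t) x) \<circ> X) \<longlonglongrightarrow> (\<lambda>(t, x). heat_semigroup t (b t) x) p"
    using heat p X by (simp add: comp_def case_prod_unfold)
qed

lemma heat_semigroup_derivative:
  assumes "0 < t" "b \<in> borel_measurable borel" "\<And>y. \<bar>b y\<bar> \<le> B"
  shows "(heat_semigroup t b has_real_derivative deriv (heat_semigroup t b) x) (at x)"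
    and "(deriv (heat_semigroup t b) has_real_derivative deriv (deriv (heat_semigroup t b)) x) (at x)"
  using heat_semigroup_smooth[OF assms] unfolding smooth_def
  by (metis DERIV_deriv_iff_real_differentiable funpow_0, 
      metis (no_types) DERIV_deriv_iff_real_differentiable funpow_0 funpow.simps(2) comp_apply)

lemma heat_equation:
  assumes "0 < t"
    and meas: "\<And>s. 0 < s \<Longrightarrow> b s \<in> borel_measurable borel" "\<And>s. 0 < s \<Longrightarrow> bt s \<in> borel_measurable borel"
    and B: "\<And>s y. 0 < s \<Longrightarrow> \<bar>b s y\<bar> \<le> B" and B': "\<And>s y. 0 < s \<Longrightarrow> \<bar>bt s y\<bar> \<le> B'"
    and bt: "\<And>s y. 0 < s \<Longrightarrow> ((\<lambda>s. b s y) has_real_derivative bt s y) (at s)"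
  shows "((\<lambda>s. heat_semigroup s (b s) x) has_real_derivative
     deriv (deriv (heat_semigroup t (b t))) x + heat_semigroup t (bt t) x) (at t)"
proof -
  have "deriv (deriv (heat_semigroup t (b t))) x = (deriv ^^ 2) (heat_semigroup t (b t)) x"
    by (simp add: numeral_2_eq_2)
  also have "\<dots> = (\<integral>y. poly (gauss_pderiv t (gauss_pderiv t 1)) (x - y) * heat_kernel t (x - y) * b t y \<partial>lborel)"
    by (simp only: heat_semigroup_iterated_deriv[OF \<open>0 < t\<close> meas(1)[OF \<open>0 < t\<close>] B[OF \<open>0 < t\<close>]]) (simp add: numeral_2_eq_2)
  finally show ?thesis
    using heat_semigroup_time_derivative[OF assms, of x] by simp
qed

text \<open>
  The constant is the \<open>L\<^sup>1\<close> norm of the space derivative of the kernel, that is, its first absolute moment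
  \<open>2 sqrt (t / \<pi>)\<close> divided by \<open>2 t\<close>.
\<close>

lemma heat_semigroup_deriv_abs_le:
  assumes "0 < t" and [measurable]: "b \<in> borel_measurable borel" and B: "\<And>y. \<bar>b y\<bar> \<le> B"
  shows "\<bar>deriv (heat_semigroup t b) x\<bar> \<le> B / sqrt (pi * t)"
proof -
  have poly: "poly (gauss_pderiv t 1) z = - z / (2 * t)" for z
    by (simp add: gauss_pderiv_def)
  have "deriv (heat_semigroup t b) x = (\<integral>y. poly (gauss_pderiv t 1) (x - y) * heat_kernel t (x - y) * b y \<partial>lborel)"
    using fun_cong[OF heat_semigroup_iterated_deriv[OF assms, of 1], of x] by simp
  moreover have "norm (\<integral>y. poly (gauss_pderiv t 1) (x - y) * heat_kernel t (x - y) * b y \<partial>lborel)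
      \<le> (\<integral>y. B / (2 * t) * (heat_kernel t (x - y) * \<bar>x - y\<bar>) \<partial>lborel)"
  proof (rule Bochner_Integration.integral_norm_bound_integral)
    show "integrable lborel (\<lambda>y. poly (gauss_pderiv t 1) (x - y) * heat_kernel t (x - y) * b y)"
      by (rule integrable_poly_heat_kernel_mult[OF assms])
    have "integrable lborel (\<lambda>y. heat_kernel t (x - y) * \<bar>x - y\<bar>)"
      using integrable_normal_moment_abs[of "sqrt (2 * t)" x 1] \<open>0 < t\<close>
      by (simp add: heat_kernel_eq_normal_density abs_minus_commute)
    thus "integrable lborel (\<lambda>y. B / (2 * t) * (heat_kernel t (x - y) * \<bar>x - y\<bar>))"
      by (rule integrable_mult_right)
    fix y
    have "\<bar>x - y\<bar> * heat_kernel t (x - y) * \<bar>b y\<bar> \<le> \<bar>x - y\<bar> * heat_kernel t (x - y) * B"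
      using B[of y] heat_kernel_nonneg[OF \<open>0 < t\<close>, of "x - y"] by (intro mult_left_mono) auto
    moreover have "norm (poly (gauss_pderiv t 1) (x - y) * heat_kernel t (x - y) * b y)
        = \<bar>x - y\<bar> * heat_kernel t (x - y) * \<bar>b y\<bar> / (2 * t)"
      unfolding poly using heat_kernel_nonneg[OF \<open>0 < t\<close>, of "x - y"] \<open>0 < t\<close>
      by (simp add: abs_mult abs_minus_commute)
    ultimately show "norm (poly (gauss_pderiv t 1) (x - y) * heat_kernel t (x - y) * b y) \<le> B / (2 * t) * (heat_kernel t (x - y) * \<bar>x - y\<bar>)"
      using \<open>0 < t\<close> by (simp add: field_simps)
  qed
  moreover have "(\<integral>y. B / (2 * t) * (heat_kernel t (x - y) * \<bar>x - y\<bar>) \<partial>lborel) = B / (2 * t) * (2 * sqrt (t / pi))"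
    by (simp add: integral_heat_kernel_abs[OF \<open>0 < t\<close>])
  moreover have "B / (2 * t) * (2 * sqrt (t / pi)) = B / sqrt (pi * t)"
    using \<open>0 < t\<close> by (simp add: real_sqrt_mult real_sqrt_divide field_simps)
  ultimately show ?thesis by simp
qed

lemma derivative_abs_le_lipschitz:
  fixes g :: "real \<Rightarrow> real"
  assumes g: "(g has_real_derivative D) (at x)" and L: "\<And>y. \<bar>g y - g x\<bar> \<le> L * \<bar>y - x\<bar>"
  shows "\<bar>D\<bar> \<le> L"
proof (rule tendsto_upperbound)
  show "((\<lambda>y. \<bar>(g y - g x) / (y - x)\<bar>) \<longlongrightarrow> \<bar>D\<bar>) (at x)"
    using g by (intro tendsto_rabs) (simp add: has_field_derivative_iff)
  show "\<forall>\<^sub>F y in at x. \<bar>(g y - g x) / (y - x)\<bar> \<le> L"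
    using L by (auto simp: eventually_at_filter field_simps abs_divide)
qed simp

lemma heat_semigroup_lipschitz:
  assumes "0 \<le> t" and [measurable]: "b \<in> borel_measurable borel" and B: "\<And>y. \<bar>b y\<bar> \<le> B"
    and L: "\<And>y y'. \<bar>b y - b y'\<bar> \<le> L * \<bar>y - y'\<bar>"
  shows "\<bar>heat_semigroup t b x - heat_semigroup t b x'\<bar> \<le> L * \<bar>x - x'\<bar>"
proof -
  have int: "integrable lborel (\<lambda>\<eta>. std_normal_density \<eta> * b (z + sqrt (2 * t) * \<eta>))" for z
    using B by (intro integrable_std_normal_mult) auto
  have "heat_semigroup t b x - heat_semigroup t b x'
      = (\<integral>\<eta>. std_normal_density \<eta> * b (x + sqrt (2 * t) * \<eta>) - std_normal_density \<eta> * b (x' + sqrt (2 * t) * \<eta>) \<partial>lborel)"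
    by (simp add: heat_semigroup_normal[OF assms(1)] int)
  moreover have "norm (\<integral>\<eta>. std_normal_density \<eta> * b (x + sqrt (2 * t) * \<eta>) - std_normal_density \<eta> * b (x' + sqrt (2 * t) * \<eta>) \<partial>lborel)
      \<le> (\<integral>\<eta>. std_normal_density \<eta> * (L * \<bar>x - x'\<bar>) \<partial>lborel)"
  proof (rule Bochner_Integration.integral_norm_bound_integral)
    show "norm (std_normal_density \<eta> * b (x + sqrt (2 * t) * \<eta>) - std_normal_density \<eta> * b (x' + sqrt (2 * t) * \<eta>))
        \<le> std_normal_density \<eta> * (L * \<bar>x - x'\<bar>)" for \<eta>
      using L[of "x + sqrt (2 * t) * \<eta>" "x' + sqrt (2 * t) * \<eta>"]
      by (auto simp: abs_mult mult_left_mono simp flip: right_diff_distrib)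
    show "integrable lborel (\<lambda>\<eta>. std_normal_density \<eta> * (L * \<bar>x - x'\<bar>))"
      by (intro integrable_mult_left) simp
  qed (intro Bochner_Integration.integrable_diff int)
  ultimately show ?thesis by simp
qed

text \<open>
  Expanding \<open>f\<close> at the mean \<open>m\<close> of \<open>b\<close> kills the first-order term and leaves \<open>M / 2\<close> times the variance,
  which is at most the second moment about any other point \<open>c\<close>.
\<close>

lemma heat_semigroup_jensen_gap:
  assumes "0 < t" and [measurable]: "b \<in> borel_measurable borel" and K: "\<And>y. \<bar>b y\<bar> \<le> K"
    and f1: "\<And>r. (f has_real_derivative f1 r) (at r)"
    and f2: "\<And>r. (f1 has_real_derivative f2 r) (at r)"
    and M: "\<And>r. \<bar>r\<bar> \<le> K \<Longrightarrow> \<bar>f2 r\<bar> \<le> M"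
  shows "\<bar>heat_semigroup t (\<lambda>y. f (b y)) x - f (heat_semigroup t b x)\<bar>
    \<le> M / 2 * (\<integral>y. heat_kernel t (x - y) * (b y - c)\<^sup>2 \<partial>lborel)"
proof -
  define m where "m = heat_semigroup t b x"
  define G where "G y = heat_kernel t (x - y)" for y
  have [measurable]: "G \<in> borel_measurable borel" unfolding G_def by measurable
  have G: "0 \<le> G y" for y using heat_kernel_nonneg[OF \<open>0 < t\<close>] by (simp add: G_def)
  have [measurable]: "f \<in> borel_measurable borel"
    by (meson DERIV_isCont borel_measurable_continuous_onI continuous_at_imp_continuous_on f1)
  have "0 \<le> K" using K[of 0] by linarith
  have "0 \<le> M" using M[of 0] \<open>0 \<le> K\<close> by (auto intro: order_trans[OF abs_ge_zero])
  have m: "\<bar>m\<bar> \<le> K" unfolding m_def using \<open>0 < t\<close> K by (intro heat_semigroup_abs_le) auto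
  have "continuous_on {-K..K} f"
    by (meson DERIV_isCont continuous_at_imp_continuous_on f1)
  then obtain F where F: "\<And>r. -K \<le> r \<Longrightarrow> r \<le> K \<Longrightarrow> \<bar>f r\<bar> \<le> F"
    using continuous_on_interval_bounded by blast
  have F: "\<bar>f (b y)\<bar> \<le> F" for y
    using K[of y] by (intro F) auto
  have int_f: "integrable lborel (\<lambda>y. G y * f (b y))"
    unfolding G_def using K F \<open>0 < t\<close> by (intro integrable_heat_kernel_mult[where B = F]) auto
  have int_b: "integrable lborel (\<lambda>y. G y * b y)"
    unfolding G_def using K \<open>0 < t\<close> by (intro integrable_heat_kernel_mult[where B = K]) auto
  have int_sq: "integrable lborel (\<lambda>y. G y * (b y)\<^sup>2)"
    unfolding G_def using K \<open>0 < t\<close>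
    by (intro integrable_heat_kernel_mult[where B = "K\<^sup>2"]) (auto simp: abs_le_square_iff[symmetric] intro: order_trans[OF K abs_ge_self])
  have int_1: "integrable lborel G" and one: "integral\<^sup>L lborel G = 1"
    using \<open>0 < t\<close> by (simp_all add: G_def[abs_def] heat_kernel_eq_normal_density)
  have mean: "(\<integral>y. G y * b y \<partial>lborel) = m"
    using \<open>0 < t\<close> by (simp add: m_def heat_semigroup_def G_def)
  have sq: "G y * (b y - a)\<^sup>2 = G y * (b y)\<^sup>2 - 2 * a * (G y * b y) + a\<^sup>2 * G y" for y a
    by (simp add: power2_eq_square algebra_simps)
  \<comment> \<open>Steiner's formula: the second moment about \<open>a\<close> is the variance plus \<open>(m - a)\<^sup>2\<close>.\<close>
  have var: "integrable lborel (\<lambda>y. G y * (b y - a)\<^sup>2)"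
      "(\<integral>y. G y * (b y - a)\<^sup>2 \<partial>lborel) = (\<integral>y. G y * (b y)\<^sup>2 \<partial>lborel) - 2 * a * m + a\<^sup>2" for a
    unfolding sq using int_sq int_b int_1 by (auto simp: mean one)
  have "heat_semigroup t (\<lambda>y. f (b y)) x - f m
      = (\<integral>y. G y * f (b y) - f m * G y - f1 m * (G y * b y - m * G y) \<partial>lborel)"
    using \<open>0 < t\<close> int_f int_b int_1 by (simp add: mean one heat_semigroup_def flip: G_def)
  moreover have "norm (\<integral>y. G y * f (b y) - f m * G y - f1 m * (G y * b y - m * G y) \<partial>lborel)
      \<le> (\<integral>y. M / 2 * (G y * (b y - m)\<^sup>2) \<partial>lborel)"
  proof (rule Bochner_Integration.integral_norm_bound_integral)
    fix y
    have "G y * \<bar>f (b y) - f m - f1 m * (b y - m)\<bar> \<le> G y * (M / 2 * (b y - m)\<^sup>2)"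
      using first_order_taylor_bound[OF f1 f2 M m K] G by (intro mult_left_mono) auto
    thus "norm (G y * f (b y) - f m * G y - f1 m * (G y * b y - m * G y)) \<le> M / 2 * (G y * (b y - m)\<^sup>2)"
      using G[of y] by (simp add: abs_mult_pos' algebra_simps)
  qed (use int_f int_b int_1 var in auto)
  moreover have "(\<integral>y. M / 2 * (G y * (b y - m)\<^sup>2) \<partial>lborel) = M / 2 * (\<integral>y. G y * (b y - m)\<^sup>2 \<partial>lborel)" by simp
  moreover have "M / 2 * (\<integral>y. G y * (b y - m)\<^sup>2 \<partial>lborel) \<le> M / 2 * (\<integral>y. G y * (b y - c)\<^sup>2 \<partial>lborel)"
  proof (rule mult_left_mono)
    have "(\<integral>y. G y * (b y - c)\<^sup>2 \<partial>lborel) = (\<integral>y. G y * (b y - m)\<^sup>2 \<partial>lborel) + (m - c)\<^sup>2"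
      unfolding var by (simp add: power2_eq_square algebra_simps)
    thus "(\<integral>y. G y * (b y - m)\<^sup>2 \<partial>lborel) \<le> (\<integral>y. G y * (b y - c)\<^sup>2 \<partial>lborel)" by simp
  qed (use \<open>0 \<le> M\<close> in simp)
  ultimately show ?thesis by (simp add: m_def G_def)
qed

text \<open>
  With \<open>c = b x\<close>, one factor of \<open>(b y - b x)\<^sup>2\<close> is bounded by \<open>2 K\<close> and the other by \<open>L \<bar>x - y\<bar>\<close>.
\<close>

lemma heat_semigroup_jensen_gap_lipschitz:
  assumes "0 < t" and [measurable]: "b \<in> borel_measurable borel" and K: "\<And>y. \<bar>b y\<bar> \<le> K"
    and L: "\<And>y y'. \<bar>b y - b y'\<bar> \<le> L * \<bar>y - y'\<bar>"
    and f1: "\<And>r. (f has_real_derivative f1 r) (at r)"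
    and f2: "\<And>r. (f1 has_real_derivative f2 r) (at r)"
    and M: "\<And>r. \<bar>r\<bar> \<le> K \<Longrightarrow> \<bar>f2 r\<bar> \<le> M"
  shows "\<bar>heat_semigroup t (\<lambda>y. f (b y)) x - f (heat_semigroup t b x)\<bar> \<le> 2 * K * M * L * sqrt (t / pi)"
proof -
  have "0 \<le> K" using K[of 0] by linarith
  have "0 \<le> M" using M[of 0] \<open>0 \<le> K\<close> by (auto intro: order_trans[OF abs_ge_zero])
  have "(\<integral>y. heat_kernel t (x - y) * (b y - b x)\<^sup>2 \<partial>lborel)
      \<le> (\<integral>y. 2 * K * L * (heat_kernel t (x - y) * \<bar>x - y\<bar>) \<partial>lborel)"
  proof (rule integral_mono)
    have b: "(b y - b x)\<^sup>2 \<le> 2 * K * (L * \<bar>x - y\<bar>)" for y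
    proof -
      have "\<bar>b y - b x\<bar> \<le> 2 * K" using K[of x] K[of y] by linarith
      hence "\<bar>b y - b x\<bar> * \<bar>b y - b x\<bar> \<le> 2 * K * (L * \<bar>y - x\<bar>)"
        using L[of y x] \<open>0 \<le> K\<close> by (intro mult_mono) auto
      moreover have "\<bar>b y - b x\<bar> * \<bar>b y - b x\<bar> = (b y - b x)\<^sup>2"
        by (simp add: power2_eq_square)
      ultimately show ?thesis by (simp add: abs_minus_commute)
    qed
    have "\<bar>(b y - b x)\<^sup>2\<bar> \<le> (2 * K)\<^sup>2" for y
    proof -
      have "\<bar>b y - b x\<bar> \<le> 2 * K" using K[of x] K[of y] by linarith
      hence "\<bar>b y - b x\<bar>\<^sup>2 \<le> (2 * K)\<^sup>2" by (intro power_mono) auto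
      thus ?thesis by simp
    qed
    thus "integrable lborel (\<lambda>y. heat_kernel t (x - y) * (b y - b x)\<^sup>2)"
      by (intro integrable_heat_kernel_mult[OF \<open>0 < t\<close>]) auto
    show "integrable lborel (\<lambda>y. 2 * K * L * (heat_kernel t (x - y) * \<bar>x - y\<bar>))"
      using integrable_normal_moment_abs[of "sqrt (2 * t)" x 1] \<open>0 < t\<close>
      by (intro integrable_mult_right) (simp add: heat_kernel_eq_normal_density abs_minus_commute)
    show "heat_kernel t (x - y) * (b y - b x)\<^sup>2 \<le> 2 * K * L * (heat_kernel t (x - y) * \<bar>x - y\<bar>)" for y
      using mult_left_mono[OF b[of y] heat_kernel_nonneg[OF \<open>0 < t\<close>, of "x - y"]] by (simp add: mult_ac)
  qed
  also have "\<dots> = 2 * K * L * (2 * sqrt (t / pi))"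
    by (simp only: integral_mult_right_zero integral_heat_kernel_abs[OF \<open>0 < t\<close>])
  finally have "M / 2 * (\<integral>y. heat_kernel t (x - y) * (b y - b x)\<^sup>2 \<partial>lborel) \<le> M / 2 * (2 * K * L * (2 * sqrt (t / pi)))"
    using \<open>0 \<le> M\<close> by (intro mult_left_mono) auto
  with heat_semigroup_jensen_gap[OF assms(1,2) K f1 f2 M, of x "b x"]
  show ?thesis by (simp add: mult_ac)
qed

section \<open>Defects of the splitting products\<close>

text \<open>
  The function \<open>H = c s sqrt s exp (a s)\<close> solves \<open>H' = a H + h\<close> with \<open>h\<close> of order \<open>sqrt s\<close>, the size of the
  defects that involve \<open>\<partial>\<^sub>x u\<^sub>0\<close>.
\<close>

lemma growth_barrier_derivative:
  assumes "0 < s"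
  shows "((\<lambda>s. c * (s * sqrt s) * exp (a * s)) has_real_derivative
    3 / 2 * c * sqrt s * exp (a * s) + a * (c * (s * sqrt s) * exp (a * s))) (at s)"
proof -
  have "s * inverse (sqrt s) = sqrt s"
    using assms by (simp add: field_simps)
  thus ?thesis
    using assms by (auto intro!: derivative_eq_intros simp: algebra_simps)
qed

context dissipative_reaction
begin

text \<open>
  Both \<open>u\<close> and \<open>z\<close> have values in \<open>[-K, K]\<close>, where \<open>f\<close> has Lipschitz constant \<open>M\<close>, so the difference
  satisfies a linear inequality forced by the defect \<open>g\<close> of \<open>z\<close>.
\<close>

lemma approximate_solution_error:
  fixes z zt zx zxx g :: "real \<Rightarrow> real \<Rightarrow> real"
  assumes u: "reaction_diffusion_solution f u0 u"
    and u0: "\<And>x. \<bar>u0 x\<bar> \<le> K" and "1 \<le> K" and M: "\<And>r. \<bar>r\<bar> \<le> K \<Longrightarrow> \<bar>f1 r\<bar> \<le> M"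
    and "0 \<le> t"
    and z_cont: "continuous_on ({0..} \<times> UNIV) (\<lambda>(s, x). z s x)"
    and z_bound: "\<And>s x. 0 \<le> s \<Longrightarrow> \<bar>z s x\<bar> \<le> K"
    and z_0: "z 0 = u0"
    and zt: "\<And>s x. 0 < s \<Longrightarrow> ((\<lambda>s. z s x) has_real_derivative zt s x) (at s)"
    and zx: "\<And>s x. 0 < s \<Longrightarrow> (z s has_real_derivative zx s x) (at x)"
    and zxx: "\<And>s x. 0 < s \<Longrightarrow> (zx s has_real_derivative zxx s x) (at x)"
    and z_eq: "\<And>s x. 0 < s \<Longrightarrow> zt s x - zxx s x = f (z s x) + g s x"
    and g: "\<And>s x. 0 < s \<Longrightarrow> s \<le> t \<Longrightarrow> \<bar>g s x\<bar> \<le> H' s - M * H s"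
    and contH: "continuous_on {0..t} H"
    and H': "\<And>s. 0 < s \<Longrightarrow> s \<le> t \<Longrightarrow> (H has_real_derivative H' s) (at s)"
    and H: "\<And>s. 0 \<le> s \<Longrightarrow> s \<le> t \<Longrightarrow> 0 \<le> H s"
  shows "\<bar>u t x - z t x\<bar> \<le> H t"
proof -
  from u obtain ut ux uxx where u_0: "u 0 = u0"
    and u_cont: "continuous_on ({0..} \<times> UNIV) (\<lambda>(s, x). u s x)"
    and u_bdd: "\<And>\<tau>. bounded ((\<lambda>(t, x). u t x) ` ({0..\<tau>} \<times> UNIV))"
    and ut: "\<And>s x. 0 < s \<Longrightarrow> ((\<lambda>s. u s x) has_real_derivative ut s x) (at s)"
    and ux: "\<And>s x. 0 < s \<Longrightarrow> (u s has_real_derivative ux s x) (at x)"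
    and uxx: "\<And>s x. 0 < s \<Longrightarrow> (ux s has_real_derivative uxx s x) (at x)"
    and u_eq: "\<And>s x. 0 < s \<Longrightarrow> ut s x - uxx s x = f (u s x)"
    unfolding reaction_diffusion_solution_def by blast
  have u_bound: "\<bar>u s x\<bar> \<le> K" if "0 \<le> s" for s x
  proof -
    obtain B where B: "\<And>r x. 0 \<le> r \<Longrightarrow> r \<le> s \<Longrightarrow> \<bar>u r x\<bar> \<le> B"
      using u_bdd[of s] by (force simp: bounded_iff)
    show ?thesis
      by (rule reaction_diffusion_invariant_interval[OF dissip _ B ut ux uxx u_eq])
        (use u_0 u0 \<open>1 \<le> K\<close> that in \<open>auto intro: continuous_on_subset[OF u_cont]\<close>)
  qed
  show ?thesis
  proof (rule parabolic_estimate[where d = "\<lambda>s x. u s x - z s x" and dt = "\<lambda>s x. ut s x - zt s x"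
        and dx = "\<lambda>s x. ux s x - zx s x" and dxx = "\<lambda>s x. uxx s x - zxx s x" and B = "2 * K"
        and p = "\<lambda>s x. f (u s x) - f (z s x)" and g = "\<lambda>s x. - g s x" and M = M and H = H and H' = H'])
    have "continuous_on ({0..} \<times> UNIV) (\<lambda>(s, x). u s x - z s x)"
      using continuous_on_diff[OF u_cont z_cont] by (simp add: case_prod_unfold)
    thus "continuous_on ({0..t} \<times> UNIV) (\<lambda>(s, x). u s x - z s x)"
      by (rule continuous_on_subset) auto
    show "\<bar>u s x - z s x\<bar> \<le> 2 * K" if "0 \<le> s" for s x
      using u_bound[OF that, of x] z_bound[OF that, of x] by linarith
    fix s x :: real assume s: "0 < s"
    show "((\<lambda>s. u s x - z s x) has_real_derivative ut s x - zt s x) (at s)"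
      by (intro DERIV_diff ut zt s)
    show "((\<lambda>x. u s x - z s x) has_real_derivative ux s x - zx s x) (at x)"
      by (intro DERIV_diff ux zx s)
    show "((\<lambda>x. ux s x - zx s x) has_real_derivative uxx s x - zxx s x) (at x)"
      by (intro DERIV_diff uxx zxx s)
    show "ut s x - zt s x - (uxx s x - zxx s x) = f (u s x) - f (z s x) + - g s x"
      using u_eq[OF s, of x] z_eq[OF s, of x] by simp
    show "\<bar>f (u s x) - f (z s x)\<bar> \<le> M * \<bar>u s x - z s x\<bar>"
      by (rule lipschitz_bound_on_interval[OF f1 M]) (use u_bound z_bound s in auto)
  qed (use g contH H' H \<open>0 \<le> t\<close> u_0 z_0 in auto)
qed

end

context dissipative_flow
begin

lemma continuous_flow_compose:
  assumes "continuous_on UNIV u0" "0 \<le> t"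
  shows "continuous_on UNIV (\<lambda>y. \<phi> t (u0 y))"
  using flow_derivative[OF assms(2)] assms(1)
  by (intro continuous_on_compose2[OF _ assms(1), of UNIV "\<phi> t"])
    (auto intro!: continuous_at_imp_continuous_on DERIV_isCont)

text \<open>
  The time derivative falls on the kernel, giving \<open>z\<^sub>x\<^sub>x\<close>, and on the datum \<open>\<phi>(s, u\<^sub>0)\<close>, giving the
  average of \<open>f(\<phi>(s, u\<^sub>0))\<close>. The defect is therefore the Jensen gap.
\<close>

lemma heat_after_reaction_error:
  assumes u: "reaction_diffusion_solution f u0 u" and u0_cont: "continuous_on UNIV u0"
    and u0: "\<And>x. \<bar>u0 x\<bar> \<le> K" and "1 \<le> K" and M: "\<And>r. \<bar>r\<bar> \<le> K \<Longrightarrow> \<bar>f1 r\<bar> \<le> M"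
    and "0 \<le> t"
    and gap: "\<And>s x. 0 < s \<Longrightarrow> s \<le> t \<Longrightarrow>
      \<bar>heat_semigroup s (\<lambda>y. f (\<phi> s (u0 y))) x - f (heat_semigroup s (\<lambda>y. \<phi> s (u0 y)) x)\<bar> \<le> H' s - M * H s"
    and contH: "continuous_on {0..t} H"
    and H': "\<And>s. 0 < s \<Longrightarrow> s \<le> t \<Longrightarrow> (H has_real_derivative H' s) (at s)"
    and H: "\<And>s. 0 \<le> s \<Longrightarrow> s \<le> t \<Longrightarrow> 0 \<le> H s"
  shows "\<bar>u t x - heat_semigroup t (\<lambda>y. \<phi> t (u0 y)) x\<bar> \<le> H t"
proof -
  define b where "b s y = \<phi> s (u0 y)" for s y
  define bt where "bt s y = f (b s y)" for s y
  have contf: "continuous_on UNIV f"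
    by (meson DERIV_isCont continuous_at_imp_continuous_on f1)
  have b_cont: "continuous_on UNIV (b s)" if "0 \<le> s" for s
    unfolding b_def by (rule continuous_flow_compose[OF u0_cont that])
  have b_meas: "b s \<in> borel_measurable borel" if "0 \<le> s" for s
    using b_cont[OF that] by (rule borel_measurable_continuous_onI)
  have bt_meas: "bt s \<in> borel_measurable borel" if "0 \<le> s" for s
    unfolding bt_def
    by (rule borel_measurable_continuous_onI) (rule continuous_on_compose2[OF contf b_cont[OF that]], auto)
  have b_bound: "\<bar>b s y\<bar> \<le> K" if "0 \<le> s" for s y
    unfolding b_def by (rule flow_abs_le[OF u0 \<open>1 \<le> K\<close> that])
  obtain F where F: "\<And>r. \<bar>r\<bar> \<le> K \<Longrightarrow> \<bar>f r\<bar> \<le> F"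
    using bound_on_interval[OF contf] by blast
  have bt: "((\<lambda>s. b s y) has_real_derivative bt s y) (at s)" if "0 < s" for s y
    using solves_at[OF flow_solves that] by (simp add: b_def bt_def)
  have b_joint: "continuous_on ({0..} \<times> UNIV) (\<lambda>(s, y). b s y)"
  proof -
    have "continuous_on ({0..} \<times> UNIV) (\<lambda>p. (\<lambda>(s, r). \<phi> s r) (fst p, u0 (snd p)))"
      by (intro continuous_on_compose2[OF flow_jointly_continuous] continuous_intros
          continuous_on_compose2[OF u0_cont]) auto
    thus ?thesis by (simp add: b_def case_prod_unfold)
  qed
  define z where "z s = heat_semigroup s (b s)" for s
  have "\<bar>u t x - z t x\<bar> \<le> H t"
  proof (rule approximate_solution_error[OF u u0 \<open>1 \<le> K\<close> M \<open>0 \<le> t\<close>])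
    show "continuous_on ({0..} \<times> UNIV) (\<lambda>(s, x). z s x)"
      unfolding z_def by (rule heat_semigroup_jointly_continuous[OF b_joint b_bound])
    show "\<bar>z s x\<bar> \<le> K" if "0 \<le> s" for s x
      unfolding z_def by (rule heat_semigroup_abs_le[OF that b_meas[OF that] b_bound[OF that]])
    show "z 0 = u0"
      by (simp add: z_def heat_semigroup_def b_def[abs_def] flow_0)
    fix s x :: real assume s: "0 < s"
    show "((\<lambda>s. z s x) has_real_derivative deriv (deriv (z s)) x + heat_semigroup s (bt s) x) (at s)"
      unfolding z_def
      by (rule heat_equation[where B = K and B' = F])
        (use s b_meas bt_meas b_bound F bt in \<open>auto simp: bt_def[abs_def]\<close>)
    note deriv = heat_semigroup_derivative[OF s b_meas[OF less_imp_le[OF s]] b_bound[OF less_imp_le[OF s]], folded z_def]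
    show "(z s has_real_derivative deriv (z s) x) (at x)" by (rule deriv(1))
    show "(deriv (z s) has_real_derivative deriv (deriv (z s)) x) (at x)" by (rule deriv(2))
    show "deriv (deriv (z s)) x + heat_semigroup s (bt s) x - deriv (deriv (z s)) x
        = f (z s x) + (heat_semigroup s (bt s) x - f (z s x))"
      by simp
    show "\<bar>heat_semigroup s (bt s) x - f (z s x)\<bar> \<le> H' s - M * H s" if "s \<le> t"
      using gap[OF s that, of x] by (simp add: z_def b_def[abs_def] bt_def[abs_def])
  qed (use contH H' H in auto)
  thus ?thesis by (simp add: z_def b_def[abs_def])
qed

text \<open>
  The chain rule applied to \<open>\<phi>(s, v)\<close> produces \<open>\<phi>\<^sub>r v\<^sub>t\<close> and \<open>\<phi>\<^sub>r v\<^sub>x\<^sub>x\<close>, which cancel by the heat equation,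
  and leaves the defect \<open>- \<phi>\<^sub>r\<^sub>r v\<^sub>x\<^sup>2\<close>.
\<close>

lemma reaction_after_heat_error:
  assumes u: "reaction_diffusion_solution f u0 u" and u0_cont: "continuous_on UNIV u0"
    and u0: "\<And>x. \<bar>u0 x\<bar> \<le> K" and "1 \<le> K" and M: "\<And>r. \<bar>r\<bar> \<le> K \<Longrightarrow> \<bar>f1 r\<bar> \<le> M"
    and M2: "\<And>r. \<bar>r\<bar> \<le> K \<Longrightarrow> \<bar>f2 r\<bar> \<le> M2"
    and "0 \<le> t"
    and defect: "\<And>s x. 0 < s \<Longrightarrow> s \<le> t \<Longrightarrow>
      s * M2 * exp (2 * M * s) * (deriv (heat_semigroup s u0) x)\<^sup>2 \<le> H' s - M * H s"
    and contH: "continuous_on {0..t} H"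
    and H': "\<And>s. 0 < s \<Longrightarrow> s \<le> t \<Longrightarrow> (H has_real_derivative H' s) (at s)"
    and H: "\<And>s. 0 \<le> s \<Longrightarrow> s \<le> t \<Longrightarrow> 0 \<le> H s"
  shows "\<bar>u t x - \<phi> t (heat_semigroup t u0 x)\<bar> \<le> H t"
proof -
  define v where "v s = heat_semigroup s u0" for s
  have u0_meas: "u0 \<in> borel_measurable borel"
    using u0_cont by (rule borel_measurable_continuous_onI)
  have v_cont: "continuous_on ({0..} \<times> UNIV) (\<lambda>(s, x). v s x)"
  proof -
    have "continuous_on ({0..} \<times> UNIV) (\<lambda>(s :: real, y). u0 y)"
      unfolding case_prod_unfold by (intro continuous_on_compose2[OF u0_cont] continuous_intros) auto
    from heat_semigroup_jointly_continuous[OF this u0] show ?thesis by (simp add: v_def)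
  qed
  have v_bound: "\<bar>v s x\<bar> \<le> K" if "0 \<le> s" for s x
    unfolding v_def by (rule heat_semigroup_abs_le[OF that u0_meas u0])
  have v: "(v s has_real_derivative deriv (v s) x) (at x)"
    "(deriv (v s) has_real_derivative deriv (deriv (v s)) x) (at x)"
    "((\<lambda>s. v s x) has_real_derivative deriv (deriv (v s)) x) (at s)" if "0 < s" for s x
  proof -
    show "(v s has_real_derivative deriv (v s) x) (at x)"
      "(deriv (v s) has_real_derivative deriv (deriv (v s)) x) (at x)"
      unfolding v_def by (rule heat_semigroup_derivative[OF that u0_meas u0])+
    have "((\<lambda>s. heat_semigroup s u0 x) has_real_derivative
        deriv (deriv (heat_semigroup s u0)) x + heat_semigroup s (\<lambda>y. 0) x) (at s)"
      by (rule heat_equation[OF that, of "\<lambda>s. u0" "\<lambda>s y. 0" K 0]) (auto intro: u0_meas u0)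
    thus "((\<lambda>s. v s x) has_real_derivative deriv (deriv (v s)) x) (at s)"
      using that by (simp add: v_def heat_semigroup_def)
  qed
  define w where "w s x = \<phi> s (v s x)" for s x
  have "\<bar>u t x - w t x\<bar> \<le> H t"
  proof (rule approximate_solution_error[OF u u0 \<open>1 \<le> K\<close> M \<open>0 \<le> t\<close>])
    have "continuous_on ({0..} \<times> UNIV) (\<lambda>p. (\<lambda>(s, r). \<phi> s r) (fst p, (\<lambda>(s, x). v s x) p))"
      by (intro continuous_on_compose2[OF flow_jointly_continuous] continuous_intros v_cont) auto
    thus "continuous_on ({0..} \<times> UNIV) (\<lambda>(s, x). w s x)"
      by (simp add: w_def case_prod_unfold)
    show "\<bar>w s x\<bar> \<le> K" if "0 \<le> s" for s x
      unfolding w_def by (rule flow_abs_le[OF v_bound[OF that] \<open>1 \<le> K\<close> that])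
    show "w 0 = u0"
      by (simp add: w_def[abs_def] v_def heat_semigroup_def flow_0)
    fix s x :: real assume s: "0 < s"
    show "((\<lambda>s. w s x) has_real_derivative f (w s x) + jacobian s (v s x) * deriv (deriv (v s)) x) (at s)"
      unfolding w_def by (rule flow_along_curve_derivative[OF s v(3)[OF s]])
    show "(w s has_real_derivative jacobian s (v s x) * deriv (v s) x) (at x)"
      unfolding w_def by (rule DERIV_chain2[OF flow_derivative v(1)]) (use s in auto)
    show "((\<lambda>x. jacobian s (v s x) * deriv (v s) x) has_real_derivative
        jacobian s (v s x) * jacobian_log_deriv s (v s x) * deriv (v s) x * deriv (v s) x + deriv (deriv (v s)) x * jacobian s (v s x)) (at x)"
      by (rule DERIV_mult[OF DERIV_chain2[OF jacobian_derivative v(1)] v(2)]) (use s in auto)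
    show "f (w s x) + jacobian s (v s x) * deriv (deriv (v s)) x
        - (jacobian s (v s x) * jacobian_log_deriv s (v s x) * deriv (v s) x * deriv (v s) x + deriv (deriv (v s)) x * jacobian s (v s x))
        = f (w s x) + - (jacobian s (v s x) * jacobian_log_deriv s (v s x) * (deriv (v s) x)\<^sup>2)"
      by (simp add: power2_eq_square)
    show "\<bar>- (jacobian s (v s x) * jacobian_log_deriv s (v s x) * (deriv (v s) x)\<^sup>2)\<bar> \<le> H' s - M * H s" if "s \<le> t"
    proof -
      have "\<bar>jacobian s (v s x) * jacobian_log_deriv s (v s x)\<bar> \<le> s * M2 * exp (2 * M * s)"
        by (rule jacobian_derivative_abs_le[OF v_bound \<open>1 \<le> K\<close> M M2]) (use s in auto)
      hence "\<bar>jacobian s (v s x) * jacobian_log_deriv s (v s x)\<bar> * (deriv (v s) x)\<^sup>2 \<le> s * M2 * exp (2 * M * s) * (deriv (v s) x)\<^sup>2"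
        by (intro mult_right_mono) auto
      also have "\<dots> \<le> H' s - M * H s"
        using defect[OF s that] by (simp add: v_def)
      finally show ?thesis by (simp add: abs_mult)
    qed
  qed (use contH H' H in auto)
  thus ?thesis by (simp add: w_def v_def)
qed

lemma heat_after_reaction_bound:
  assumes u: "reaction_diffusion_solution f u0 u" and u0_cont: "continuous_on UNIV u0"
    and u0: "\<And>x. \<bar>u0 x\<bar> \<le> K" and "1 \<le> K" and M: "\<And>r. \<bar>r\<bar> \<le> K \<Longrightarrow> \<bar>f1 r\<bar> \<le> M"
    and M2: "\<And>r. \<bar>r\<bar> \<le> K \<Longrightarrow> \<bar>f2 r\<bar> \<le> M2"
    and L: "\<And>y y'. \<bar>u0 y - u0 y'\<bar> \<le> L * \<bar>y - y'\<bar>"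
    and "0 \<le> t"
  shows "\<bar>u t x - heat_semigroup t (\<lambda>y. \<phi> t (u0 y)) x\<bar>
    \<le> 4 * K * t * sqrt t * exp (t * M) * M2 / (3 * sqrt pi) * L"
proof -
  have "0 \<le> M" "0 \<le> M2" using M[of 0] M2[of 0] \<open>1 \<le> K\<close> by auto
  have "0 \<le> L" using L[of 1 0] abs_ge_zero[of "u0 1 - u0 0"] by simp
  define c where "c = 4 / 3 * K * M2 * L / sqrt pi"
  have "0 \<le> c" using \<open>0 \<le> M2\<close> \<open>0 \<le> L\<close> \<open>1 \<le> K\<close> by (simp add: c_def)
  have "\<bar>u t x - heat_semigroup t (\<lambda>y. \<phi> t (u0 y)) x\<bar> \<le> c * (t * sqrt t) * exp (M * t)"
  proof (rule heat_after_reaction_error[OF u u0_cont u0 \<open>1 \<le> K\<close> M \<open>0 \<le> t\<close> _ _ growth_barrier_derivative])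
    fix s x :: real assume s: "0 < s"
    have meas: "(\<lambda>y. \<phi> s (u0 y)) \<in> borel_measurable borel"
      using continuous_flow_compose[OF u0_cont, of s] s by (intro borel_measurable_continuous_onI) auto
    have lip: "\<bar>\<phi> s (u0 y) - \<phi> s (u0 y')\<bar> \<le> exp (M * s) * L * \<bar>y - y'\<bar>" for y y'
    proof -
      have "\<bar>\<phi> s (u0 y) - \<phi> s (u0 y')\<bar> \<le> exp (M * s) * \<bar>u0 y - u0 y'\<bar>"
        using s by (intro flow_diff_le[OF u0 u0 \<open>1 \<le> K\<close> M]) auto
      also have "\<dots> \<le> exp (M * s) * (L * \<bar>y - y'\<bar>)"
        using L by (intro mult_left_mono) auto
      finally show ?thesis by simp
    qed
    have "\<bar>heat_semigroup s (\<lambda>y. f (\<phi> s (u0 y))) x - f (heat_semigroup s (\<lambda>y. \<phi> s (u0 y)) x)\<bar>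
        \<le> 2 * K * M2 * (exp (M * s) * L) * sqrt (s / pi)"
      by (rule heat_semigroup_jensen_gap_lipschitz[OF s meas flow_abs_le[OF u0 \<open>1 \<le> K\<close>] lip f1 f2 M2])
        (use s in auto)
    also have "\<dots> = 3 / 2 * c * sqrt s * exp (M * s) + M * (c * (s * sqrt s) * exp (M * s)) - M * (c * (s * sqrt s) * exp (M * s))"
      by (simp add: c_def real_sqrt_divide)
    finally show "\<bar>heat_semigroup s (\<lambda>y. f (\<phi> s (u0 y))) x - f (heat_semigroup s (\<lambda>y. \<phi> s (u0 y)) x)\<bar>
        \<le> 3 / 2 * c * sqrt s * exp (M * s) + M * (c * (s * sqrt s) * exp (M * s)) - M * (c * (s * sqrt s) * exp (M * s))" .
  next
    show "continuous_on {0..t} (\<lambda>s. c * (s * sqrt s) * exp (M * s))"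
      by (intro continuous_intros)
    show "0 \<le> c * (s * sqrt s) * exp (M * s)" if "0 \<le> s" for s
      using that \<open>0 \<le> c\<close> by simp
  qed
  thus ?thesis by (simp add: c_def mult_ac)
qed

text \<open>
  If \<open>f\<close> is affine on \<open>[-K, K]\<close>, averaging commutes with it and the Jensen gap vanishes for every bounded datum;
  this is the case in which the estimate has content although \<open>\<partial>\<^sub>x u\<^sub>0\<close> is unbounded.
\<close>

lemma heat_after_reaction_exact:
  assumes u: "reaction_diffusion_solution f u0 u" and u0_cont: "continuous_on UNIV u0"
    and u0: "\<And>x. \<bar>u0 x\<bar> \<le> K" and "1 \<le> K" and M: "\<And>r. \<bar>r\<bar> \<le> K \<Longrightarrow> \<bar>f1 r\<bar> \<le> M"
    and M2: "\<And>r. \<bar>r\<bar> \<le> K \<Longrightarrow> \<bar>f2 r\<bar> \<le> M2"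
    and "0 \<le> t" and "t = 0 \<or> M2 = 0"
  shows "u t x = heat_semigroup t (\<lambda>y. \<phi> t (u0 y)) x"
proof -
  have "\<bar>u t x - heat_semigroup t (\<lambda>y. \<phi> t (u0 y)) x\<bar> \<le> 0"
  proof (rule heat_after_reaction_error[OF u u0_cont u0 \<open>1 \<le> K\<close> M \<open>0 \<le> t\<close>, where H = "\<lambda>s. 0" and H' = "\<lambda>s. 0"])
    fix s x :: real assume s: "0 < s" "s \<le> t"
    have meas: "(\<lambda>y. \<phi> s (u0 y)) \<in> borel_measurable borel"
      using continuous_flow_compose[OF u0_cont, of s] s by (intro borel_measurable_continuous_onI) auto
    have "\<bar>heat_semigroup s (\<lambda>y. f (\<phi> s (u0 y))) x - f (heat_semigroup s (\<lambda>y. \<phi> s (u0 y)) x)\<bar>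
        \<le> M2 / 2 * (\<integral>y. heat_kernel s (x - y) * (\<phi> s (u0 y) - 0)\<^sup>2 \<partial>lborel)"
      by (rule heat_semigroup_jensen_gap[OF s(1) meas flow_abs_le[OF u0 \<open>1 \<le> K\<close>] f1 f2 M2])
        (use s in auto)
    thus "\<bar>heat_semigroup s (\<lambda>y. f (\<phi> s (u0 y))) x - f (heat_semigroup s (\<lambda>y. \<phi> s (u0 y)) x)\<bar> \<le> 0 - M * 0"
      using assms(8) s by simp
  qed auto
  thus ?thesis by simp
qed

lemma reaction_after_heat_bound:
  assumes u: "reaction_diffusion_solution f u0 u" and u0_cont: "continuous_on UNIV u0"
    and u0: "\<And>x. \<bar>u0 x\<bar> \<le> B" and "B \<le> K" and "1 \<le> K" and M: "\<And>r. \<bar>r\<bar> \<le> K \<Longrightarrow> \<bar>f1 r\<bar> \<le> M"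
    and M2: "\<And>r. \<bar>r\<bar> \<le> K \<Longrightarrow> \<bar>f2 r\<bar> \<le> M2"
    and "0 \<le> t"
  shows "\<bar>u t x - \<phi> t (heat_semigroup t u0 x)\<bar> \<le> t * exp (2 * t * M) * M2 / pi * B\<^sup>2"
proof -
  have u0K: "\<bar>u0 x\<bar> \<le> K" for x using u0[of x] \<open>B \<le> K\<close> by simp
  have "0 \<le> M" "0 \<le> M2" using M[of 0] M2[of 0] \<open>1 \<le> K\<close> by auto
  define c where "c = M2 / pi * B\<^sup>2"
  have "0 \<le> c" using \<open>0 \<le> M2\<close> by (simp add: c_def)
  have "\<bar>u t x - \<phi> t (heat_semigroup t u0 x)\<bar> \<le> c * t * exp (2 * M * t)"
  proof (rule reaction_after_heat_error[OF u u0_cont u0K \<open>1 \<le> K\<close> M M2 \<open>0 \<le> t\<close>,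
        where H = "\<lambda>s. c * s * exp (2 * M * s)" and H' = "\<lambda>s. c * exp (2 * M * s) + 2 * M * (c * s * exp (2 * M * s))"])
    fix s x :: real assume s: "0 < s"
    have "\<bar>deriv (heat_semigroup s u0) x\<bar> \<le> B / sqrt (pi * s)"
      using u0 s u0_cont by (intro heat_semigroup_deriv_abs_le borel_measurable_continuous_onI) auto
    hence "\<bar>deriv (heat_semigroup s u0) x\<bar>\<^sup>2 \<le> (B / sqrt (pi * s))\<^sup>2"
      by (intro power_mono) auto
    also have "\<dots> = B\<^sup>2 / (pi * s)"
      using s by (simp add: power_divide)
    finally have "s * M2 * exp (2 * M * s) * (deriv (heat_semigroup s u0) x)\<^sup>2 \<le> s * M2 * exp (2 * M * s) * (B\<^sup>2 / (pi * s))"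
      using s \<open>0 \<le> M2\<close> by (intro mult_left_mono) auto
    also have "\<dots> = c * exp (2 * M * s)"
      using s by (simp add: c_def)
    also have "\<dots> \<le> c * exp (2 * M * s) + M * (c * s * exp (2 * M * s))"
      using s \<open>0 \<le> c\<close> \<open>0 \<le> M\<close> by simp
    finally show "s * M2 * exp (2 * M * s) * (deriv (heat_semigroup s u0) x)\<^sup>2
        \<le> c * exp (2 * M * s) + 2 * M * (c * s * exp (2 * M * s)) - M * (c * s * exp (2 * M * s))"
      by simp
    show "((\<lambda>s. c * s * exp (2 * M * s)) has_real_derivative
        c * exp (2 * M * s) + 2 * M * (c * s * exp (2 * M * s))) (at s)"
      by (auto intro!: derivative_eq_intros)
  next
    show "continuous_on {0..t} (\<lambda>s. c * s * exp (2 * M * s))"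
      by (intro continuous_intros)
    show "0 \<le> c * s * exp (2 * M * s)" if "0 \<le> s" for s
      using that \<open>0 \<le> c\<close> by simp
  qed
  thus ?thesis by (simp add: c_def mult_ac)
qed

lemma reaction_after_heat_lipschitz_bound:
  assumes u: "reaction_diffusion_solution f u0 u" and u0_cont: "continuous_on UNIV u0"
    and u0: "\<And>x. \<bar>u0 x\<bar> \<le> B" and "B \<le> K" and "1 \<le> K" and M: "\<And>r. \<bar>r\<bar> \<le> K \<Longrightarrow> \<bar>f1 r\<bar> \<le> M"
    and M2: "\<And>r. \<bar>r\<bar> \<le> K \<Longrightarrow> \<bar>f2 r\<bar> \<le> M2"
    and L: "\<And>y y'. \<bar>u0 y - u0 y'\<bar> \<le> L * \<bar>y - y'\<bar>"
    and "0 \<le> t"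
  shows "\<bar>u t x - \<phi> t (heat_semigroup t u0 x)\<bar>
    \<le> 2 * t * sqrt t * exp (2 * t * M) * M2 / (3 * sqrt pi) * B * L"
proof -
  have u0K: "\<bar>u0 x\<bar> \<le> K" for x using u0[of x] \<open>B \<le> K\<close> by simp
  have "0 \<le> M" "0 \<le> M2" using M[of 0] M2[of 0] \<open>1 \<le> K\<close> by auto
  have "0 \<le> L" using L[of 1 0] abs_ge_zero[of "u0 1 - u0 0"] by simp
  have "0 \<le> B" using u0[of 0] by linarith
  have u0_meas: "u0 \<in> borel_measurable borel"
    using u0_cont by (rule borel_measurable_continuous_onI)
  define c where "c = 2 / 3 * M2 * B * L / sqrt pi"
  have "0 \<le> c" using \<open>0 \<le> M2\<close> \<open>0 \<le> B\<close> \<open>0 \<le> L\<close> by (simp add: c_def)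
  have "\<bar>u t x - \<phi> t (heat_semigroup t u0 x)\<bar> \<le> c * (t * sqrt t) * exp (2 * M * t)"
  proof (rule reaction_after_heat_error[OF u u0_cont u0K \<open>1 \<le> K\<close> M M2 \<open>0 \<le> t\<close> _ _ growth_barrier_derivative])
    fix s x :: real assume s: "0 < s"
    let ?D = "deriv (heat_semigroup s u0) x"
    have "\<bar>?D\<bar> \<le> B / sqrt (pi * s)"
      by (rule heat_semigroup_deriv_abs_le[OF s u0_meas u0])
    moreover have "\<bar>?D\<bar> \<le> L"
      by (rule derivative_abs_le_lipschitz[OF heat_semigroup_derivative(1)[OF s u0_meas u0]
            heat_semigroup_lipschitz[OF less_imp_le[OF s] u0_meas u0 L]])
    ultimately have "\<bar>?D\<bar> * \<bar>?D\<bar> \<le> B / sqrt (pi * s) * L"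
      using \<open>0 \<le> B\<close> s by (intro mult_mono) auto
    hence "s * M2 * exp (2 * M * s) * ?D\<^sup>2 \<le> s * M2 * exp (2 * M * s) * (B / sqrt (pi * s) * L)"
      using s \<open>0 \<le> M2\<close> by (intro mult_left_mono) (auto simp: power2_eq_square)
    also have "\<dots> = 3 / 2 * c * (s / sqrt s) * exp (2 * M * s)"
      by (simp add: c_def real_sqrt_mult)
    also have "s / sqrt s = sqrt s" using s by (simp add: real_div_sqrt)
    also have "3 / 2 * c * sqrt s * exp (2 * M * s)
        \<le> 3 / 2 * c * sqrt s * exp (2 * M * s) + M * (c * (s * sqrt s) * exp (2 * M * s))"
      using s \<open>0 \<le> c\<close> \<open>0 \<le> M\<close> by simp
    finally show "s * M2 * exp (2 * M * s) * ?D\<^sup>2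
        \<le> 3 / 2 * c * sqrt s * exp (2 * M * s) + 2 * M * (c * (s * sqrt s) * exp (2 * M * s)) - M * (c * (s * sqrt s) * exp (2 * M * s))"
      by simp
  next
    show "continuous_on {0..t} (\<lambda>s. c * (s * sqrt s) * exp (2 * M * s))"
      by (intro continuous_intros)
    show "0 \<le> c * (s * sqrt s) * exp (2 * M * s)" if "0 \<le> s" for s
      using that \<open>0 \<le> c\<close> by simp
  qed
  thus ?thesis by (simp add: c_def mult_ac)
qed

end

section \<open>Sup norms and the error estimates\<close>

lemma smooth_has_derivative:
  assumes "smooth g"
  shows "((deriv ^^ n) g has_real_derivative (deriv ^^ Suc n) g x) (at x)"
  using assms unfolding smooth_def by (simp add: DERIV_deriv_iff_real_differentiable)

lemma const_in_Cb_infty: "(\<lambda>_. c) \<in> Cb_infty"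
proof -
  have "(deriv ^^ n) (\<lambda>_ :: real. c) = (\<lambda>_. if n = 0 then c else 0)" for n
    by (induction n) auto
  thus ?thesis by (auto simp: Cb_infty_def smooth_def)
qed

lemma sup_norm_leI: "(\<And>x. \<bar>g x\<bar> \<le> c) \<Longrightarrow> sup_norm g \<le> ennreal c"
  unfolding sup_norm_def by (intro SUP_least ennreal_leI)

lemma abs_le_sup_norm:
  assumes "sup_norm g = ennreal c" "0 \<le> c"
  shows "\<bar>g x\<bar> \<le> c"
proof -
  have "ennreal \<bar>g x\<bar> \<le> ennreal c"
    unfolding assms(1)[symmetric] sup_norm_def by (rule SUP_upper) simp
  thus ?thesis using assms(2) by (simp add: ennreal_le_iff)
qed

lemma sup_norm_bounded:
  assumes "bounded (range g)"
  shows "sup_norm g = ennreal (enn2real (sup_norm g))"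
proof -
  from assms obtain c where "\<And>x. \<bar>g x\<bar> \<le> c" by (auto simp: bounded_iff)
  hence "sup_norm g \<le> ennreal c" by (rule sup_norm_leI)
  hence "sup_norm g < top" by (rule le_less_trans) simp
  thus ?thesis by (simp add: ennreal_enn2real)
qed

lemma abs_le_sup_norm_on:
  assumes "continuous_on UNIV g" "\<bar>r\<bar> \<le> a"
  shows "\<bar>g r\<bar> \<le> sup_norm_on a g"
proof -
  have "continuous_on {-a..a} g" using assms(1) by (rule continuous_on_subset) simp
  then obtain B where "\<And>s. -a \<le> s \<Longrightarrow> s \<le> a \<Longrightarrow> \<bar>g s\<bar> \<le> B"
    using continuous_on_interval_bounded by blast
  hence "bdd_above ((\<lambda>r. \<bar>g r\<bar>) ` {-a..a})" by (intro bdd_aboveI2[of _ _ B]) auto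
  thus ?thesis
    unfolding sup_norm_on_def using assms(2) by (intro cSUP_upper) auto
qed

text \<open>
  Constant functions belong to \<^const>\<open>Cb_infty\<close>, so the given reaction semiflow contains its own scalar flow
  \<open>\<phi>(s, r) = Y\<^sup>s r\<close>, and uniqueness for the scalar equation gives \<open>Y\<^sup>s w\<^sub>0 = \<phi>(s, w\<^sub>0)\<close>. The same holds for the
  datum \<open>X\<^sup>t u\<^sub>0\<close> because the heat semigroup maps into \<^const>\<open>Cb_infty\<close>.
\<close>

theorem theorem4:
  fixes f u0 :: "real \<Rightarrow> real"
    and T Y :: "real \<Rightarrow> (real \<Rightarrow> real) \<Rightarrow> real \<Rightarrow> real"
    and Tmax t \<kappa> :: real
  assumes "smooth f" and "f 0 = 0"
    and "\<And>r. \<bar>r\<bar> \<ge> 1 \<Longrightarrow> r * f r \<le> 0"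
    and "reaction_diffusion_semiflow f T"
    and "reaction_semiflow f Y"
    and "Tmax > 0" and "t \<in> {0..<Tmax}"
    and "u0 \<in> Cb_infty"
    and "\<kappa> = max (enn2real (sup_norm u0)) 1"
  shows
    "sup_norm (\<lambda>x. T t u0 x - heat_semigroup t (Y t u0) x)
       \<le> ennreal (4 * \<kappa> * t * sqrt t * exp (t * sup_norm_on \<kappa> (deriv f))
                    * sup_norm_on \<kappa> (deriv (deriv f)) / (3 * sqrt pi))
          * sup_norm (deriv u0)
     \<and> sup_norm (\<lambda>x. T t u0 x - Y t (heat_semigroup t u0) x)
       \<le> ennreal (2 * t * sqrt t * exp (2 * t * sup_norm_on \<kappa> (deriv f))
                    * sup_norm_on \<kappa> (deriv (deriv f)) / (3 * sqrt pi))
          * sup_norm u0 * sup_norm (deriv u0)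
     \<and> sup_norm (\<lambda>x. T t u0 x - Y t (heat_semigroup t u0) x)
       \<le> ennreal (t * exp (2 * t * sup_norm_on \<kappa> (deriv f))
                    * sup_norm_on \<kappa> (deriv (deriv f)) / pi)
          * (sup_norm u0)\<^sup>2"
proof -
  have "0 \<le> t" using \<open>t \<in> {0..<Tmax}\<close> by simp
  define \<phi> where "\<phi> s r = Y s (\<lambda>_. r) 0" for s r
  have Y: "Y 0 w0 = w0" "0 \<le> s \<Longrightarrow> ((\<lambda>s. Y s w0 x) has_real_derivative f (Y s w0 x)) (at s within {0..})"
    if "w0 \<in> Cb_infty" for w0 s x
    using assms(5) that unfolding reaction_semiflow_def reaction_solution_def by auto
  have deriv_f: "(f has_real_derivative deriv f r) (at r)"
    "(deriv f has_real_derivative deriv (deriv f) r) (at r)"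
    "(deriv (deriv f) has_real_derivative deriv (deriv (deriv f)) r) (at r)"
    "(deriv (deriv (deriv f)) has_real_derivative deriv (deriv (deriv (deriv f))) r) (at r)" for r
    using smooth_has_derivative[OF \<open>smooth f\<close>, of 0 r] smooth_has_derivative[OF \<open>smooth f\<close>, of 1 r]
      smooth_has_derivative[OF \<open>smooth f\<close>, of 2 r] smooth_has_derivative[OF \<open>smooth f\<close>, of 3 r]
    by (simp_all add: numeral_2_eq_2 numeral_3_eq_3)
  interpret dissipative_reaction f "deriv f" "deriv (deriv f)" "deriv (deriv (deriv f))"
  proof
    show "continuous_on UNIV (deriv (deriv (deriv f)))"
      by (meson DERIV_isCont continuous_at_imp_continuous_on deriv_f(4))
  qed (use deriv_f assms(3) in auto)
  have solves_Y: "solves (\<lambda>s. Y s w0 x)" if "w0 \<in> Cb_infty" for w0 x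
    unfolding solves_def using Y(2)[OF that] by blast
  interpret dissipative_flow f "deriv f" "deriv (deriv f)" "deriv (deriv (deriv f))" \<phi>
  proof
    show "\<phi> 0 r = r" for r
      by (simp add: \<phi>_def Y(1)[OF const_in_Cb_infty])
    show "solves (\<lambda>t. \<phi> t r)" for r
      unfolding \<phi>_def by (rule solves_Y[OF const_in_Cb_infty])
  qed
  have Y_flow: "Y s w0 = (\<lambda>x. \<phi> s (w0 x))" if "w0 \<in> Cb_infty" "0 \<le> s" for w0 s
  proof
    show "Y s w0 x = \<phi> s (w0 x)" for x
      by (rule solves_unique[OF solves_Y[OF that(1)] flow_solves _ that(2)])
        (simp add: Y(1)[OF that(1)] flow_0)
  qed

  define B where "B = enn2real (sup_norm u0)"
  define M where "M = sup_norm_on \<kappa> (deriv f)"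
  define M2 where "M2 = sup_norm_on \<kappa> (deriv (deriv f))"
  have "smooth u0" "bounded (range u0)"
    using \<open>u0 \<in> Cb_infty\<close> by (auto simp: Cb_infty_def)
  have norm_u0: "sup_norm u0 = ennreal B"
    unfolding B_def by (rule sup_norm_bounded[OF \<open>bounded (range u0)\<close>])
  have "0 \<le> B" by (simp add: B_def)
  have u0_B: "\<bar>u0 x\<bar> \<le> B" for x by (rule abs_le_sup_norm[OF norm_u0 \<open>0 \<le> B\<close>])
  have \<kappa>: "B \<le> \<kappa>" "1 \<le> \<kappa>" using assms(9) by (auto simp: B_def)
  have u0_\<kappa>: "\<bar>u0 x\<bar> \<le> \<kappa>" for x using u0_B[of x] \<kappa> by linarith
  have M: "\<bar>deriv f r\<bar> \<le> M" if "\<bar>r\<bar> \<le> \<kappa>" for r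
    unfolding M_def by (rule abs_le_sup_norm_on[OF continuous_f1 that])
  have M2: "\<bar>deriv (deriv f) r\<bar> \<le> M2" if "\<bar>r\<bar> \<le> \<kappa>" for r
    unfolding M2_def by (rule abs_le_sup_norm_on[OF continuous_f2 that])
  have "0 \<le> M2" using M2[of 0] \<kappa> by auto
  have u0_deriv: "(u0 has_real_derivative deriv u0 x) (at x)" for x
    using smooth_has_derivative[OF \<open>smooth u0\<close>, of 0 x] by simp
  have u0_cont: "continuous_on UNIV u0"
    by (meson DERIV_isCont continuous_at_imp_continuous_on u0_deriv)
  have u: "reaction_diffusion_solution f u0 (\<lambda>t. T t u0)"
    using assms(4) \<open>u0 \<in> Cb_infty\<close> by (simp add: reaction_diffusion_semiflow_def)
  have heat_u0: "heat_semigroup t u0 \<in> Cb_infty"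
  proof (cases "t = 0")
    case True
    thus ?thesis using \<open>u0 \<in> Cb_infty\<close> by (simp add: heat_semigroup_def)
  next
    case False
    have meas: "u0 \<in> borel_measurable borel" using u0_cont by (rule borel_measurable_continuous_onI)
    have "bounded (range (heat_semigroup t u0))"
      using heat_semigroup_abs_le[OF \<open>0 \<le> t\<close> meas u0_B] by (auto simp: bounded_iff)
    thus ?thesis
      using heat_semigroup_smooth[OF _ meas u0_B, of t] False \<open>0 \<le> t\<close> by (auto simp: Cb_infty_def)
  qed
  have XY: "heat_semigroup t (Y t u0) = heat_semigroup t (\<lambda>y. \<phi> t (u0 y))"
    by (simp add: Y_flow[OF \<open>u0 \<in> Cb_infty\<close> \<open>0 \<le> t\<close>])
  have YX: "Y t (heat_semigroup t u0) = (\<lambda>x. \<phi> t (heat_semigroup t u0 x))"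
    by (rule Y_flow[OF heat_u0 \<open>0 \<le> t\<close>])
  have lipschitz: "\<bar>u0 y - u0 y'\<bar> \<le> L * \<bar>y - y'\<bar>" if "sup_norm (deriv u0) = ennreal L" "0 \<le> L" for L y y'
  proof -
    have "norm (u0 y - u0 y') \<le> L * norm (y - y')"
      by (rule field_differentiable_bound[of UNIV u0 "deriv u0"])
        (use u0_deriv abs_le_sup_norm[OF that] in auto)
    thus ?thesis by simp
  qed
  define a1 where "a1 = 4 * \<kappa> * t * sqrt t * exp (t * M) * M2 / (3 * sqrt pi)"
  define a2 where "a2 = 2 * t * sqrt t * exp (2 * t * M) * M2 / (3 * sqrt pi)"
  define a3 where "a3 = t * exp (2 * t * M) * M2 / pi"
  have a_nonneg: "0 \<le> a1" "0 \<le> a2" "0 \<le> a3"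
    using \<open>0 \<le> t\<close> \<open>0 \<le> M2\<close> \<kappa> by (simp_all add: a1_def a2_def a3_def)
  have a_zero: "a1 = 0 \<longleftrightarrow> t = 0 \<or> M2 = 0" "a2 = 0 \<longleftrightarrow> t = 0 \<or> M2 = 0" "a3 = 0 \<longleftrightarrow> t = 0 \<or> M2 = 0"
    using \<kappa> by (auto simp: a1_def a2_def a3_def)

  have third: "sup_norm (\<lambda>x. T t u0 x - Y t (heat_semigroup t u0) x) \<le> ennreal (a3 * B\<^sup>2)"
    unfolding YX a3_def
    by (intro sup_norm_leI reaction_after_heat_bound[OF u u0_cont u0_B \<kappa> M M2 \<open>0 \<le> t\<close>])
  hence 3: "sup_norm (\<lambda>x. T t u0 x - Y t (heat_semigroup t u0) x) \<le> ennreal a3 * (sup_norm u0)\<^sup>2"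
    using a_nonneg \<open>0 \<le> B\<close> by (simp add: norm_u0 ennreal_mult ennreal_power)

  have 1: "sup_norm (\<lambda>x. T t u0 x - heat_semigroup t (Y t u0) x) \<le> ennreal a1 * sup_norm (deriv u0)"
  proof (cases "sup_norm (deriv u0)")
    case (real L)
    have "sup_norm (\<lambda>x. T t u0 x - heat_semigroup t (Y t u0) x) \<le> ennreal (a1 * L)"
      unfolding XY a1_def
      by (intro sup_norm_leI heat_after_reaction_bound[OF u u0_cont u0_\<kappa> \<kappa>(2) M M2 lipschitz \<open>0 \<le> t\<close>] real)
    thus ?thesis using a_nonneg real by (simp add: ennreal_mult)
  next
    case top
    show ?thesis
    proof (cases "a1 = 0")
      case True
      hence "T t u0 x = heat_semigroup t (Y t u0) x" for x
        unfolding XY using a_zero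
        by (intro heat_after_reaction_exact[OF u u0_cont u0_\<kappa> \<kappa>(2) M M2 \<open>0 \<le> t\<close>]) auto
      thus ?thesis by (simp add: sup_norm_def)
    next
      case False
      thus ?thesis using a_nonneg top by (simp add: ennreal_mult_top)
    qed
  qed

  have 2: "sup_norm (\<lambda>x. T t u0 x - Y t (heat_semigroup t u0) x) \<le> ennreal a2 * sup_norm u0 * sup_norm (deriv u0)"
  proof (cases "sup_norm (deriv u0)")
    case (real L)
    have "sup_norm (\<lambda>x. T t u0 x - Y t (heat_semigroup t u0) x) \<le> ennreal (a2 * B * L)"
      unfolding YX a2_def
      by (intro sup_norm_leI reaction_after_heat_lipschitz_bound[OF u u0_cont u0_B \<kappa> M M2 lipschitz \<open>0 \<le> t\<close>] real)
    thus ?thesis using a_nonneg real \<open>0 \<le> B\<close> by (simp add: norm_u0 ennreal_mult)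
  next
    case top
    \<comment> \<open>As \<open>0 * \<infinity> = 0\<close> in \<^typ>\<open>ennreal\<close>, the right-hand side is finite only if \<open>a2\<close> or \<open>B\<close> vanishes; then the third bound vanishes too.\<close>
    show ?thesis
    proof (cases "a2 * B = 0")
      case True
      hence "a3 * B\<^sup>2 = 0" using a_zero by auto
      hence "sup_norm (\<lambda>x. T t u0 x - Y t (heat_semigroup t u0) x) = 0"
        using third by (simp only: ennreal_0 le_zero_eq)
      thus ?thesis by simp
    next
      case False
      hence "a2 \<noteq> 0" "B \<noteq> 0" by auto
      hence "ennreal a2 * sup_norm u0 * sup_norm (deriv u0) = top"
        using a_nonneg \<open>0 \<le> B\<close> by (simp add: norm_u0 top ennreal_mult_top flip: ennreal_mult)
      thus ?thesis by simp
    qed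
  qed
  show ?thesis
    using 1 2 3 by (simp add: a1_def a2_def a3_def M_def M2_def)
qed

end
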